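(* Let $(M,g)$ be a complete Riemannian manifold of dimension at least two whose Riemannian distance $d$ is Ptolemaic. Let $U\subset M$ be open and let $p,q\in\partial U$ be such that $d(p,q)>0$ and, for some $R>0$, $$d(p,q')\geq d(p,q)\quad\text{and}\quad d(q,q')\geq R\qquad\text{for all } q'\in\partial U\setminus\{p,q\}.$$ For $x,y\in U$ put $$\rho_U(x,y)=\sup_{u\in\partial U}\log\left(1+\frac{d(x,y)}{d(u,x)\,d(u,y)}\right).$$ Then $(U,\rho_U)$ is Gromov hyperbolic with parameter $\log 2$, and it is not Gromov hyperbolic with parameter $\delta$ for any $0<\delta<\log 2$.
   Context: A metric space $(X,d)$ is Ptolemaic iff $d(x,y)\,d(z,t)\leq d(x,z)\,d(y,t)+d(x,t)\,d(y,z)$ for all $x,y,z,t\in X$. A metric space $(X,d)$ is Gromov hyperbolic with parameter $\delta>0$ iff $$d(x,y)+d(z,t)\leq\max\{d(x,z)+d(y,t),\,d(x,t)+d(y,z)\}+2\delta$$ for all $x,y,z,t\in X$. $\partial U$ is the topological boundary of $U$ in $M$. It is known (Z. Zhang and Y. Xiao) that $\rho_U$ is a metric on $U$ whenever the ambient metric space is Ptolemaic and $U$ is open with non-empty boundary. It is also known that a complete Riemannian manifold has Ptolemaic distance if and only if it is a Hadamard manifold (complete, simply connected, non-positive sectional curvature). *)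

theory Defs
  imports "HOL-Analysis.Analysis"
begin

section \<open>Riemannian manifolds\<close>

text \<open>A function is of class \<open>C\<^sup>k\<close> on an open set iff all its iterated directional derivatives of
  order less than \<open>k\<close> are differentiable there and those of order \<open>k\<close> are continuous.\<close>

primrec Ck_on :: "nat \<Rightarrow> ('a::real_normed_vector \<Rightarrow> 'b::real_normed_vector) \<Rightarrow> 'a set \<Rightarrow> bool" where
  "Ck_on 0 f S \<longleftrightarrow> continuous_on S f"
| "Ck_on (Suc k) f S \<longleftrightarrow>
     (\<forall>x\<in>S. f differentiable (at x)) \<and> (\<forall>v. Ck_on k (\<lambda>x. frechet_derivative f (at x) v) S)"

definition smooth_on :: "('a::real_normed_vector \<Rightarrow> 'b::real_normed_vector) \<Rightarrow> 'a set \<Rightarrow> bool" where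
  "smooth_on f S \<longleftrightarrow> (\<forall>k. Ck_on k f S)"

text \<open>The manifold is the whole type \<open>'m\<close>; its model space is the Euclidean space \<open>'e\<close>, so its
  dimension is \<open>DIM('e)\<close>. A chart is a domain together with a coordinate map, whose values outside
  the domain are irrelevant.\<close>

type_synonym ('m, 'e) chart = "'m set \<times> ('m \<Rightarrow> 'e)"

definition is_chart :: "('m::topological_space, 'e::euclidean_space) chart \<Rightarrow> bool" where
  "is_chart = (\<lambda>(D, \<phi>). open D \<and> open (\<phi> ` D) \<and> homeomorphism D (\<phi> ` D) \<phi> (inv_into D \<phi>))"

definition transition :: "('m, 'e) chart \<Rightarrow> ('m, 'e) chart \<Rightarrow> 'e \<Rightarrow> 'e" where
  "transition c c' = snd c' \<circ> inv_into (fst c) (snd c)"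

definition smooth_atlas :: "('m::topological_space, 'e::euclidean_space) chart set \<Rightarrow> bool" where
  "smooth_atlas \<A> \<longleftrightarrow>
     (\<forall>c\<in>\<A>. is_chart c) \<and> (\<Union>c\<in>\<A>. fst c) = UNIV \<and>
     (\<forall>c\<in>\<A>. \<forall>c'\<in>\<A>. smooth_on (transition c c') (snd c ` (fst c \<inter> fst c')))"

text \<open>In a chart \<open>c\<close> around \<open>x\<close>, a tangent vector at \<open>x\<close> is given by its coordinate vector in
  \<open>'e\<close>, and coordinate vectors change with the derivative of the transition map. A Riemannian metric
  is accordingly given by its coordinate expressions: \<open>g c x v w\<close> is the inner product of the two
  tangent vectors at \<open>x\<close> whose coordinate vectors in \<open>c\<close> are \<open>v\<close> and \<open>w\<close>. The last clause
  says that this does not depend on the chart.\<close>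

type_synonym ('m, 'e) metric_tensor = "('m, 'e) chart \<Rightarrow> 'm \<Rightarrow> 'e \<Rightarrow> 'e \<Rightarrow> real"

definition riemannian_metric ::
    "('m::topological_space, 'e::euclidean_space) chart set \<Rightarrow> ('m, 'e) metric_tensor \<Rightarrow> bool" where
  "riemannian_metric \<A> g \<longleftrightarrow>
     (\<forall>c\<in>\<A>. \<forall>x\<in>fst c. bilinear (g c x) \<and> (\<forall>v w. g c x v w = g c x w v) \<and>
        (\<forall>v. v \<noteq> 0 \<longrightarrow> g c x v v > 0)) \<and>
     (\<forall>c\<in>\<A>. \<forall>v w. smooth_on (\<lambda>a. g c (inv_into (fst c) (snd c) a) v w) (snd c ` fst c)) \<and>
     (\<forall>c\<in>\<A>. \<forall>c'\<in>\<A>. \<forall>x \<in> fst c \<inter> fst c'. \<forall>v w.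
        g c x v w = g c' x (frechet_derivative (transition c c') (at (snd c x)) v)
                           (frechet_derivative (transition c c') (at (snd c x)) w))"

text \<open>Manifolds are connected, Hausdorff and second countable. Connectedness makes the distance
  below finite.\<close>

definition riemannian_manifold ::
    "('m::{t2_space, second_countable_topology}, 'e::euclidean_space) chart set
      \<Rightarrow> ('m, 'e) metric_tensor \<Rightarrow> bool" where
  "riemannian_manifold \<A> g \<longleftrightarrow>
     connected (UNIV :: 'm set) \<and> smooth_atlas \<A> \<and> riemannian_metric \<A> g"

text \<open>\<open>C\<^sup>1\<close> on a closed interval, with one-sided derivatives at the end points. The \<open>C\<^sup>1\<close>
  notion for paths of the library does not bound the velocity near break points, so the length
  integral would not always exist.\<close>

definition C1_curve_on ::
    "('m::topological_space, 'e::euclidean_space) chart set \<Rightarrow> real \<Rightarrow> real \<Rightarrow> (real \<Rightarrow> 'm) \<Rightarrow> bool" where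
  "C1_curve_on \<A> a b \<gamma> \<longleftrightarrow>
     continuous_on {a..b} \<gamma> \<and>
     (\<forall>(D, \<phi>)\<in>\<A>. \<exists>v. continuous_on {t\<in>{a..b}. \<gamma> t \<in> D} v \<and>
        (\<forall>t\<in>{a..b}. \<gamma> t \<in> D \<longrightarrow> ((\<phi> \<circ> \<gamma>) has_vector_derivative v t) (at t within {a..b})))"

definition piecewise_C1_curve ::
    "('m::topological_space, 'e::euclidean_space) chart set \<Rightarrow> (real \<Rightarrow> 'm) \<Rightarrow> bool" where
  "piecewise_C1_curve \<A> \<gamma> \<longleftrightarrow>
     (\<exists>n \<tau>. \<tau> 0 = 0 \<and> \<tau> n = 1 \<and>
        (\<forall>i<n. \<tau> i < \<tau> (Suc i) \<and> C1_curve_on \<A> (\<tau> i) (\<tau> (Suc i)) \<gamma>))"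

text \<open>The speed is computed in an arbitrary chart; by compatibility its value does not depend on the
  choice. It has no meaning at the break points, which do not contribute to the length.\<close>

definition curve_speed ::
    "('m::topological_space, 'e::euclidean_space) chart set \<Rightarrow> ('m, 'e) metric_tensor
      \<Rightarrow> (real \<Rightarrow> 'm) \<Rightarrow> real \<Rightarrow> real" where
  "curve_speed \<A> g \<gamma> t =
     (let c = (SOME c. c \<in> \<A> \<and> \<gamma> t \<in> fst c);
          v = vector_derivative (snd c \<circ> \<gamma>) (at t)
      in sqrt (g c (\<gamma> t) v v))"

definition curve_length ::
    "('m::topological_space, 'e::euclidean_space) chart set \<Rightarrow> ('m, 'e) metric_tensor
      \<Rightarrow> (real \<Rightarrow> 'm) \<Rightarrow> real" where
  "curve_length \<A> g \<gamma> = integral {0..1} (curve_speed \<A> g \<gamma>)"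

definition riemannian_dist ::
    "('m::topological_space, 'e::euclidean_space) chart set \<Rightarrow> ('m, 'e) metric_tensor
      \<Rightarrow> 'm \<Rightarrow> 'm \<Rightarrow> real" where
  "riemannian_dist \<A> g x y =
     (INF \<gamma> \<in> {\<gamma>. piecewise_C1_curve \<A> \<gamma> \<and> \<gamma> 0 = x \<and> \<gamma> 1 = y}. curve_length \<A> g \<gamma>)"


section \<open>Ptolemaic and Gromov hyperbolic metric spaces\<close>

definition ptolemaic :: "'a set \<Rightarrow> ('a \<Rightarrow> 'a \<Rightarrow> real) \<Rightarrow> bool" where
  "ptolemaic X d \<longleftrightarrow> Metric_space X d \<and>
     (\<forall>x\<in>X. \<forall>y\<in>X. \<forall>z\<in>X. \<forall>t\<in>X. d x y * d z t \<le> d x z * d y t + d x t * d y z)"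

definition gromov_hyperbolic :: "real \<Rightarrow> 'a set \<Rightarrow> ('a \<Rightarrow> 'a \<Rightarrow> real) \<Rightarrow> bool" where
  "gromov_hyperbolic \<delta> X d \<longleftrightarrow> \<delta> > 0 \<and> Metric_space X d \<and>
     (\<forall>x\<in>X. \<forall>y\<in>X. \<forall>z\<in>X. \<forall>t\<in>X.
        d x y + d z t \<le> max (d x z + d y t) (d x t + d y z) + 2 * \<delta>)"

text \<open>The value 0 off \<open>U\<close> is a convention: \<^locale>\<open>Metric_space\<close> demands nonnegativity and symmetry of the
  distance function also outside the carrier, where the supremum may be infinite.\<close>

definition rho :: "('a::topological_space \<Rightarrow> 'a \<Rightarrow> real) \<Rightarrow> 'a set \<Rightarrow> 'a \<Rightarrow> 'a \<Rightarrow> real" where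
  "rho d U x y =
     (if x \<in> U \<and> y \<in> U then SUP u\<in>frontier U. ln (1 + d x y / (d u x * d u y)) else 0)"

end

(* Each quotient d x y / (d u x * d u y) is a metric off u by Ptolemy's inequality, hence rho is a
   metric satisfying rho x y <= max (rho x z) (rho z y) + ln 2, which gives the four-point condition
   with ln 2. For sharpness, p and q are isolated in the frontier, so in dimension at least two U
   contains punctured neighbourhoods of both. Since the distance is Euclidean to first order, one
   finds x, y on opposite sides of p and z, t on opposite sides of q, all at distance about e and with
   d x y and d z t about 2 e. Then exp (rho x y) and exp (rho z t) are about 2 / e, while the four
   remaining pairs have exp (rho) about 1 / e. *)
theory Submission
  imports Defs
begin

section \<open>The metric \<open>rho\<close> over a Ptolemaic space\<close>

text \<open>The manifold enters through two facts only: each point of \<open>U\<close> has positive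
  distance to the frontier, and \<open>antipodal_at\<close> holds at \<open>p\<close> and
  \<open>q\<close>. Neither is immediate, because the topology comes from charts while the distance
  is an infimum over curves, so every competing curve has to be bounded below, including those that
  leave the chart. The factor 2 between antipodal and mixed pairs has this origin: for
  \<open>x\<close> near \<open>p\<close> and \<open>z\<close> near \<open>q\<close>, the term
  \<open>1 / d u x\<close> is large only at \<open>u = p\<close> and \<open>1 / d u z\<close> only
  at \<open>u = q\<close>, so one frontier point never sees both. Two limits follow:
  \<open>e\<close> tends to 0 for fixed \<open>\<eta>\<close>, which removes the bounded
  contributions of the other frontier points, and then \<open>\<eta>\<close> tends to 0.\<close>

lemma ln_one_plus_add_le:
  fixes a b :: real
  assumes "0 \<le> a" "0 \<le> b"
  shows "ln (1 + (a + b)) \<le> ln (1 + a) + ln (1 + b)"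
proof -
  have "1 + (a + b) \<le> (1 + a) * (1 + b)"
    using assms by (simp add: algebra_simps)
  then have "ln (1 + (a + b)) \<le> ln ((1 + a) * (1 + b))"
    using assms by (subst ln_le_cancel_iff) auto
  then show ?thesis
    using assms by (simp add: ln_mult)
qed

text \<open>\<open>1 + a + b\<close> is at most twice \<open>1 + max a b\<close>; this is where the
  constant \<open>ln 2\<close> of the upper bound comes from.\<close>

lemma ln_one_plus_add_le_max:
  fixes a b :: real
  assumes "0 \<le> a" "0 \<le> b"
  shows "ln (1 + (a + b)) \<le> max (ln (1 + a)) (ln (1 + b)) + ln 2"
proof -
  define m where "m = max a b"
  have m: "a \<le> m" "b \<le> m" "0 \<le> m"
    using assms by (auto simp: m_def)
  have "ln (1 + (a + b)) \<le> ln (2 * (1 + m))"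
    using assms m by (subst ln_le_cancel_iff) auto
  also have "\<dots> = ln (1 + m) + ln 2"
    using m ln_mult[of 2 "1 + m"] by simp
  also have "ln (1 + m) = max (ln (1 + a)) (ln (1 + b))"
    using assms by (auto simp: m_def max_def)
  finally show ?thesis .
qed

text \<open>Say \<open>r x z\<close> is the largest of the four mixed distances. Bounding
  \<open>r x y\<close> through \<open>t\<close> and \<open>r z t\<close> through \<open>y\<close>
  avoids it, and each of the four possible sums is at most \<open>r x z + r y t\<close> or equals
  \<open>r x t + r y z\<close>. The other cases are symmetric.\<close>

lemma four_point_of_quasi_ultrametric:
  fixes r :: "'a \<Rightarrow> 'a \<Rightarrow> real"
  assumes sym: "\<And>x y. r x y = r y x"
    and qu: "\<And>x y z. x \<in> X \<Longrightarrow> y \<in> X \<Longrightarrow> z \<in> X \<Longrightarrow> r x y \<le> max (r x z) (r z y) + \<delta>"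
    and "x \<in> X" "y \<in> X" "z \<in> X" "t \<in> X"
  shows "r x y + r z t \<le> max (r x z + r y t) (r x t + r y z) + 2 * \<delta>"
proof -
  note in_X = assms(3-)
  have "r x y \<le> max (r x z) (r y z) + \<delta>" "r x y \<le> max (r x t) (r y t) + \<delta>"
    "r z t \<le> max (r x z) (r x t) + \<delta>" "r z t \<le> max (r y z) (r y t) + \<delta>"
    using qu[of x y z] qu[of x y t] qu[of z t x] qu[of z t y] sym in_X by metis+
  then show ?thesis
    by linarith
qed

text \<open>Demanded for all small \<open>e\<close>, not just for some, so that pairs at two
  different centres can be taken at the same scale. Lower bounds on \<open>d p x\<close> and
  \<open>d p y\<close> follow from the triangle inequality.\<close>

definition antipodal_at :: "('a \<Rightarrow> 'a \<Rightarrow> real) \<Rightarrow> 'a set \<Rightarrow> 'a \<Rightarrow> bool" where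
  "antipodal_at d U p \<longleftrightarrow> (\<forall>\<eta>>0. \<forall>\<^sub>F e in at_right 0. \<exists>x\<in>U. \<exists>y\<in>U.
     d p x \<le> (1 + \<eta>) * e \<and> d p y \<le> (1 + \<eta>) * e \<and> 2 * (1 - \<eta>) * e \<le> d x y)"

text \<open>The topology behind \<open>frontier\<close> and the function \<open>d\<close> are
  unrelated a priori; \<open>frontier_dist\<close> is the link, and it keeps the supremum in
  \<open>rho\<close> finite.\<close>

locale ptolemaic_domain =
  fixes d :: "'a::topological_space \<Rightarrow> 'a \<Rightarrow> real" and U :: "'a set"
  assumes ptolemaic: "ptolemaic UNIV d"
    and frontier_nonempty: "frontier U \<noteq> {}"
    and frontier_dist: "x \<in> U \<Longrightarrow> \<exists>c>0. \<forall>u\<in>frontier U. c \<le> d u x"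
begin

sublocale Metric_space UNIV d
  using ptolemaic by (simp add: ptolemaic_def)

text \<open>In Euclidean space this is the distance between the images of \<open>x\<close> and
  \<open>y\<close> under inversion in the unit sphere about \<open>u\<close>.\<close>

definition inv_dist :: "'a \<Rightarrow> 'a \<Rightarrow> 'a \<Rightarrow> real" where
  "inv_dist u x y = d x y / (d u x * d u y)"

lemma rho_eq: "x \<in> U \<Longrightarrow> y \<in> U \<Longrightarrow> rho d U x y = (SUP u\<in>frontier U. ln (1 + inv_dist u x y))"
  by (simp add: rho_def inv_dist_def)

lemma frontier_dist_pos: "x \<in> U \<Longrightarrow> u \<in> frontier U \<Longrightarrow> 0 < d u x"
  using frontier_dist by force

lemma inv_dist_nonneg: "0 \<le> inv_dist u x y"
  by (simp add: inv_dist_def)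

text \<open>The triangle inequality through \<open>u\<close>, divided by
  \<open>d u x * d u y\<close>. The bound separates the two points, which serves both the finiteness
  of the supremum and the mixed pairs of the sharpness argument.\<close>

lemma inv_dist_le:
  assumes "x \<in> U" "y \<in> U" "u \<in> frontier U"
  shows "inv_dist u x y \<le> 1 / d u x + 1 / d u y"
proof -
  have pos: "0 < d u x" "0 < d u y"
    using assms frontier_dist_pos by auto
  have "d x y \<le> d u x + d u y"
    using triangle'[of x u y] commute[of x u] commute[of u y] by simp
  then show ?thesis
    using pos by (simp add: inv_dist_def field_simps)
qed

text \<open>Ptolemy's inequality for \<open>x\<close>, \<open>y\<close>, \<open>z\<close>,
  \<open>u\<close>, divided by \<open>d u x * d u y * d u z\<close>.\<close>

lemma inv_dist_triangle:
  assumes "x \<in> U" "y \<in> U" "z \<in> U" "u \<in> frontier U"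
  shows "inv_dist u x y \<le> inv_dist u x z + inv_dist u z y"
proof -
  have pos: "0 < d u x" "0 < d u y" "0 < d u z"
    using assms frontier_dist_pos by auto
  have "d x y * d z u \<le> d x z * d y u + d x u * d y z"
    using ptolemaic by (simp add: ptolemaic_def)
  then have "d x y * d u z \<le> d x z * d u y + d u x * d z y"
    by (simp add: commute)
  then show ?thesis
    using pos by (simp add: inv_dist_def field_simps)
qed

lemma bdd_above_ln_inv_dist:
  assumes "x \<in> U" "y \<in> U"
  shows "bdd_above ((\<lambda>u. ln (1 + inv_dist u x y)) ` frontier U)"
proof -
  obtain a where a: "0 < a" "\<And>u. u \<in> frontier U \<Longrightarrow> a \<le> d u x"
    using frontier_dist[OF assms(1)] by auto
  obtain b where b: "0 < b" "\<And>u. u \<in> frontier U \<Longrightarrow> b \<le> d u y"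
    using frontier_dist[OF assms(2)] by auto
  show ?thesis
  proof (rule bdd_aboveI2)
    fix u assume u: "u \<in> frontier U"
    have "1 / d u x \<le> 1 / a" "1 / d u y \<le> 1 / b"
      using a b u frontier_dist_pos assms by (auto intro!: divide_left_mono)
    then have "1 + inv_dist u x y \<le> 1 + 1 / a + 1 / b"
      using inv_dist_le[OF assms u] by linarith
    then show "ln (1 + inv_dist u x y) \<le> ln (1 + 1 / a + 1 / b)"
      using inv_dist_nonneg[of u x y] by simp
  qed
qed

lemma ln_le_rho:
  assumes "x \<in> U" "y \<in> U" "u \<in> frontier U"
  shows "ln (1 + inv_dist u x y) \<le> rho d U x y"
  using assms bdd_above_ln_inv_dist by (auto simp: rho_eq intro: cSUP_upper)

lemma rho_le:
  assumes "x \<in> U" "y \<in> U" "\<And>u. u \<in> frontier U \<Longrightarrow> ln (1 + inv_dist u x y) \<le> B"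
  shows "rho d U x y \<le> B"
  using assms frontier_nonempty by (auto simp: rho_eq intro: cSUP_least)

lemma rho_commute: "rho d U x y = rho d U y x"
  by (simp add: rho_def commute mult.commute conj_commute)

lemma ln_inv_dist_triangle:
  assumes "x \<in> U" "y \<in> U" "z \<in> U" "u \<in> frontier U"
  shows "ln (1 + inv_dist u x y) \<le> ln (1 + (inv_dist u x z + inv_dist u z y))"
  using inv_dist_triangle[OF assms] inv_dist_nonneg[of u x y] by simp

lemma rho_quasi_ultrametric:
  assumes "x \<in> U" "y \<in> U" "z \<in> U"
  shows "rho d U x y \<le> max (rho d U x z) (rho d U z y) + ln 2"
proof (rule rho_le)
  fix u assume u: "u \<in> frontier U"
  have "ln (1 + inv_dist u x y) \<le> ln (1 + (inv_dist u x z + inv_dist u z y))"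
    using ln_inv_dist_triangle assms u by blast
  also have "\<dots> \<le> max (ln (1 + inv_dist u x z)) (ln (1 + inv_dist u z y)) + ln 2"
    by (intro ln_one_plus_add_le_max inv_dist_nonneg)
  also have "\<dots> \<le> max (rho d U x z) (rho d U z y) + ln 2"
    by (intro add_right_mono max.mono ln_le_rho assms u)
  finally show "ln (1 + inv_dist u x y) \<le> max (rho d U x z) (rho d U z y) + ln 2" .
qed (use assms in auto)

lemma Metric_space_rho: "Metric_space U (rho d U)"
proof
  fix x y
  show "0 \<le> rho d U x y"
  proof (cases "x \<in> U \<and> y \<in> U")
    case True
    obtain u where u: "u \<in> frontier U"
      using frontier_nonempty by blast
    have "0 \<le> ln (1 + inv_dist u x y)"
      using inv_dist_nonneg[of u x y] by simp
    then show ?thesis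
      using ln_le_rho[of x y u] True u by linarith
  qed (auto simp: rho_def)
  show "rho d U x y = rho d U y x"
    by (rule rho_commute)
  show "(rho d U x y = 0) = (x = y)" if xy: "x \<in> U" "y \<in> U"
  proof
    assume "x = y"
    then show "rho d U x y = 0"
      using xy frontier_nonempty by (simp add: rho_def)
  next
    assume "rho d U x y = 0"
    obtain u where u: "u \<in> frontier U"
      using frontier_nonempty by blast
    have "ln (1 + inv_dist u x y) \<le> 0"
      using ln_le_rho[OF xy u] \<open>rho d U x y = 0\<close> by simp
    then have "inv_dist u x y = 0"
      using inv_dist_nonneg[of u x y] by simp
    then show "x = y"
      using frontier_dist_pos[of x u] frontier_dist_pos[of y u] xy u by (auto simp: inv_dist_def)
  qed
next
  fix x y z assume xyz: "x \<in> U" "y \<in> U" "z \<in> U"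
  show "rho d U x z \<le> rho d U x y + rho d U y z"
  proof (rule rho_le)
    fix u assume u: "u \<in> frontier U"
    have "ln (1 + inv_dist u x z) \<le> ln (1 + (inv_dist u x y + inv_dist u y z))"
      using ln_inv_dist_triangle xyz u by blast
    also have "\<dots> \<le> ln (1 + inv_dist u x y) + ln (1 + inv_dist u y z)"
      by (intro ln_one_plus_add_le inv_dist_nonneg)
    also have "\<dots> \<le> rho d U x y + rho d U y z"
      by (intro add_mono ln_le_rho xyz u)
    finally show "ln (1 + inv_dist u x z) \<le> rho d U x y + rho d U y z" .
  qed (use xyz in auto)
qed

lemma gromov_hyperbolic_rho: "gromov_hyperbolic (ln 2) U (rho d U)"
  unfolding gromov_hyperbolic_def
  using Metric_space_rho
    four_point_of_quasi_ultrametric[of "rho d U", OF rho_commute rho_quasi_ultrametric]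
  by auto

section \<open>Sharpness of the constant in a Ptolemaic space\<close>

text \<open>The supremum is bounded below by its single term at \<open>u = p\<close>, whose
  numerator is of order \<open>e\<close> and whose denominator is of order
  \<open>e^2\<close>.\<close>

lemma ln_le_rho_antipodal:
  assumes "p \<in> frontier U" "x \<in> U" "y \<in> U" "0 < e" "0 < \<eta>" "\<eta> < 1"
    and "d p x \<le> (1 + \<eta>) * e" "d p y \<le> (1 + \<eta>) * e" "2 * (1 - \<eta>) * e \<le> d x y"
  shows "ln (2 * (1 - \<eta>) / (1 + \<eta>)^2 / e) \<le> rho d U x y"
proof -
  have pos: "0 < d p x" "0 < d p y"
    using assms frontier_dist_pos by auto
  have "2 * (1 - \<eta>) / (1 + \<eta>)^2 / e = 2 * (1 - \<eta>) * e / (((1 + \<eta>) * e) * ((1 + \<eta>) * e))"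
    using assms by (simp add: power2_eq_square)
  also have "\<dots> \<le> d x y / (d p x * d p y)"
    using assms pos by (intro frac_le mult_mono mult_pos_pos) auto
  also have "\<dots> \<le> 1 + inv_dist p x y"
    by (simp add: inv_dist_def)
  finally have "2 * (1 - \<eta>) / (1 + \<eta>)^2 / e \<le> 1 + inv_dist p x y" .
  moreover have "0 < 2 * (1 - \<eta>) / (1 + \<eta>)^2 / e"
    using assms by (intro divide_pos_pos) auto
  ultimately have "ln (2 * (1 - \<eta>) / (1 + \<eta>)^2 / e) \<le> ln (1 + inv_dist p x y)"
    by simp
  also have "\<dots> \<le> rho d U x y"
    by (rule ln_le_rho) (use assms in auto)
  finally show ?thesis .
qed

text \<open>A frontier point other than \<open>p\<close> is at least \<open>D\<close> from
  \<open>p\<close>, hence at least \<open>D / 2\<close> from \<open>x\<close>; likewise for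
  \<open>q\<close>, \<open>R\<close> and \<open>z\<close>. Only \<open>u = p\<close> makes
  \<open>1 / d u x\<close> as large as \<open>1 / s\<close>, and only \<open>u = q\<close> does so
  for \<open>1 / d u z\<close>. As \<open>p\<close> and \<open>q\<close> differ, the bound contains
  \<open>1 / s\<close> once instead of twice.\<close>

lemma rho_between_le:
  assumes xz: "x \<in> U" "z \<in> U" and "0 < s"
    and D: "0 < D" "\<And>u. u \<in> frontier U - {p} \<Longrightarrow> D \<le> d p u" "d p x \<le> D / 2" "s \<le> d p x"
    and R: "0 < R" "\<And>u. u \<in> frontier U - {q} \<Longrightarrow> R \<le> d q u" "d q z \<le> R / 2" "s \<le> d q z"
    and "p \<noteq> q"
  shows "rho d U x z \<le> ln (1 + 1 / s + 2 / D + 2 / R)"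
proof (rule rho_le)
  fix u assume u: "u \<in> frontier U"
  note pos = frontier_dist_pos[OF xz(1) u] frontier_dist_pos[OF xz(2) u]
  have x: "1 / d u x \<le> (if u = p then 1 / s else 2 / D)"
  proof (cases "u = p")
    case True
    then show ?thesis
      using D(4) \<open>0 < s\<close> by (simp add: frac_le)
  next
    case False
    then have "D \<le> d p x + d x u"
      using D(2)[of u] u triangle[of p x u] by simp
    then have "D / 2 \<le> d u x"
      using D(3) commute[of u x] by simp
    then have "1 / d u x \<le> 1 / (D / 2)"
      using D(1) pos by (intro divide_left_mono) auto
    then show ?thesis
      using False by simp
  qed
  have z: "1 / d u z \<le> (if u = q then 1 / s else 2 / R)"
  proof (cases "u = q")
    case True
    then show ?thesis
      using R(4) \<open>0 < s\<close> by (simp add: frac_le)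
  next
    case False
    then have "R \<le> d q z + d z u"
      using R(2)[of u] u triangle[of q z u] by simp
    then have "R / 2 \<le> d u z"
      using R(3) commute[of u z] by simp
    then have "1 / d u z \<le> 1 / (R / 2)"
      using R(1) pos by (intro divide_left_mono) auto
    then show ?thesis
      using False by simp
  qed
  have "inv_dist u x z \<le> 1 / d u x + 1 / d u z"
    using inv_dist_le xz u by blast
  also have "\<dots> \<le> 1 / s + 2 / D + 2 / R"
  proof -
    have "0 < 1 / s" "0 < 2 / D" "0 < 2 / R"
      using \<open>0 < s\<close> D(1) R(1) by auto
    then show ?thesis
      using x z \<open>p \<noteq> q\<close> by (smt (verit))
  qed
  finally show "ln (1 + inv_dist u x z) \<le> ln (1 + 1 / s + 2 / D + 2 / R)"
    using inv_dist_nonneg[of u x z] by simp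
qed (use xz in auto)

text \<open>At scale \<open>e\<close> the antipodal pairs have \<open>exp (rho d U x y)\<close> about \<open>2 / e\<close>, whereas the pairs
  consisting of a point near \<open>p\<close> and a point near \<open>q\<close> have \<open>exp (rho d U x z)\<close> about \<open>1 / e\<close>.\<close>

lemma not_gromov_hyperbolic_rho:
  assumes p: "p \<in> frontier U" "antipodal_at d U p"
    and q: "q \<in> frontier U" "antipodal_at d U q"
    and "p \<noteq> q"
    and D: "0 < D" "\<And>u. u \<in> frontier U - {p} \<Longrightarrow> D \<le> d p u"
    and R: "0 < R" "\<And>u. u \<in> frontier U - {q} \<Longrightarrow> R \<le> d q u"
    and "\<delta> < ln 2"
  shows "\<not> gromov_hyperbolic \<delta> U (rho d U)"
proof
  assume hyp: "gromov_hyperbolic \<delta> U (rho d U)"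
  \<comment> \<open>For fixed \<open>\<eta>\<close> the exponentiated four-point inequality is
    multiplied by \<open>e\<close>, and \<open>e\<close> tends to 0; this removes the bounded terms
    \<open>1 + 2 / D + 2 / R\<close>. The restriction \<open>\<eta> < 1 / 3\<close> makes
    \<open>s\<close> below positive.\<close>
  have eta: "2 * (1 - \<eta>) / (1 + \<eta>)^2 \<le> exp \<delta> * (1 / (1 - 3 * \<eta>))"
    if \<eta>: "0 < \<eta>" "\<eta> < 1 / 3" for \<eta>
  proof (rule tendsto_lowerbound)
    show "((\<lambda>e. exp \<delta> * (1 / (1 - 3 * \<eta>) + (1 + 2 / D + 2 / R) * e)) \<longlongrightarrow> exp \<delta> * (1 / (1 - 3 * \<eta>)))
      (at_right 0)"
      by (auto intro!: tendsto_eq_intros)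
    have small: "\<forall>\<^sub>F e in at_right 0. (1 + \<eta>) * e < m" if "0 < m" for m
    proof -
      have "((\<lambda>e. (1 + \<eta>) * e) \<longlongrightarrow> 0) (at_right 0)"
        by (auto intro!: tendsto_eq_intros)
      then show ?thesis
        using that by (auto dest: order_tendstoD)
    qed
    have "\<forall>\<^sub>F e in at_right (0::real). 0 < e"
      by (simp add: eventually_at_right_less)
    moreover have "\<forall>\<^sub>F e in at_right 0. (1 + \<eta>) * e < D / 2" "\<forall>\<^sub>F e in at_right 0. (1 + \<eta>) * e < R / 2"
      using small[of "D / 2"] small[of "R / 2"] D(1) R(1) by simp_all
    moreover note p(2)[unfolded antipodal_at_def, rule_format, OF \<eta>(1)]
      q(2)[unfolded antipodal_at_def, rule_format, OF \<eta>(1)]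
    ultimately show "\<forall>\<^sub>F e in at_right 0. 2 * (1 - \<eta>) / (1 + \<eta>)^2
        \<le> exp \<delta> * (1 / (1 - 3 * \<eta>) + (1 + 2 / D + 2 / R) * e)"
    proof eventually_elim
      case (elim e)
      obtain x y where xy: "x \<in> U" "y \<in> U" "d p x \<le> (1 + \<eta>) * e" "d p y \<le> (1 + \<eta>) * e"
        "2 * (1 - \<eta>) * e \<le> d x y"
        using elim by blast
      obtain z t where zt: "z \<in> U" "t \<in> U" "d q z \<le> (1 + \<eta>) * e" "d q t \<le> (1 + \<eta>) * e"
        "2 * (1 - \<eta>) * e \<le> d z t"
        using elim by blast
      \<comment> \<open>Least distance of a point to its centre: \<open>2 * (1 - \<eta>) * e\<close>
        for the pair, less the at most \<open>(1 + \<eta>) * e\<close> covered by its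
        partner.\<close>
      define s where "s = (1 - 3 * \<eta>) * e"
      \<comment> \<open>\<open>L\<close> bounds \<open>exp\<close> of \<open>rho\<close> from below
        on the two antipodal pairs, \<open>B\<close> from above on the four mixed ones.\<close>
      define L where "L = 2 * (1 - \<eta>) / (1 + \<eta>)^2 / e"
      define B where "B = 1 + 1 / s + 2 / D + 2 / R"
      have "0 < s"
        using elim \<eta> by (simp add: s_def)
      have "0 < L"
        unfolding L_def using elim \<eta> by (intro divide_pos_pos) auto
      have "0 < B"
        using \<open>0 < s\<close> D(1) R(1) by (simp add: B_def add_pos_pos)
      have "d x y \<le> d p x + d p y" "d z t \<le> d q z + d q t"
        using triangle'[of x p y] triangle'[of z q t] by (simp_all add: commute)
      then have s: "s \<le> d p x" "s \<le> d p y" "s \<le> d q z" "s \<le> d q t"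
        using xy zt by (auto simp: s_def algebra_simps)
      have cross: "rho d U x' z' \<le> ln B"
        if "x' \<in> {x, y}" "z' \<in> {z, t}" for x' z'
        unfolding B_def
        by (rule rho_between_le[where p = p and q = q])
          (use that xy zt s D R elim \<open>0 < s\<close> \<open>p \<noteq> q\<close> in auto)
      have "ln L + ln L \<le> rho d U x y + rho d U z t"
        unfolding L_def
        by (intro add_mono ln_le_rho_antipodal) (use p q xy zt elim \<eta> in auto)
      also have "\<dots> \<le> max (rho d U x z + rho d U y t) (rho d U x t + rho d U y z) + 2 * \<delta>"
        using hyp xy zt by (auto simp: gromov_hyperbolic_def)
      also have "\<dots> \<le> (ln B + ln B) + 2 * \<delta>"
        by (intro add_right_mono max.boundedI add_mono cross) auto
      finally have "ln L \<le> \<delta> + ln B"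
        by simp
      then have "exp (ln L) \<le> exp (\<delta> + ln B)"
        by simp
      then have "L \<le> exp \<delta> * B"
        using \<open>0 < L\<close> \<open>0 < B\<close> by (simp add: exp_add)
      then have "L * e \<le> exp \<delta> * B * e"
        using elim by (simp add: mult_right_mono)
      also have "\<dots> = exp \<delta> * (1 / (1 - 3 * \<eta>) + (1 + 2 / D + 2 / R) * e)"
      proof -
        have "1 / s * e = 1 / (1 - 3 * \<eta>)"
          using elim by (simp add: s_def)
        then have "B * e = 1 / (1 - 3 * \<eta>) + (1 + 2 / D + 2 / R) * e"
          by (simp only: B_def distrib_right)
        then show ?thesis
          by (simp only: mult.assoc)
      qed
      finally show ?case
        using elim by (simp add: L_def)
    qed
  qed auto
  \<comment> \<open>The second limit, \<open>\<eta>\<close> to 0, in the inequality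
    \<open>eta\<close>.\<close>
  have "2 \<le> exp \<delta>"
  proof (rule tendsto_le)
    show "((\<lambda>\<eta>. exp \<delta> * (1 / (1 - 3 * \<eta>))) \<longlongrightarrow> exp \<delta>) (at_right 0)"
      "((\<lambda>\<eta>. 2 * (1 - \<eta>) / (1 + \<eta>)^2) \<longlongrightarrow> (2::real)) (at_right 0)"
      by (auto intro!: tendsto_eq_intros)
    show "\<forall>\<^sub>F \<eta> in at_right 0. 2 * (1 - \<eta>) / (1 + \<eta>)^2 \<le> exp \<delta> * (1 / (1 - 3 * \<eta>))"
      unfolding eventually_at_right_field by (rule exI[of _ "1/3"]) (use eta in auto)
  qed auto
  then have "ln 2 \<le> ln (exp \<delta>)"
    by (subst ln_le_cancel_iff) auto
  then show False
    using \<open>\<delta> < ln 2\<close> by simp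
qed

end

section \<open>Inner products\<close>

text \<open>The inner product varies with the base point, so it is a parameter here and not the one
  of the type class of \<open>'e\<close>.\<close>

locale inner_form =
  fixes B :: "'e::euclidean_space \<Rightarrow> 'e \<Rightarrow> real"
  assumes bilinear: "bilinear B"
    and sym: "B v w = B w v"
    and pos: "v \<noteq> 0 \<Longrightarrow> 0 < B v v"
begin

definition fnorm :: "'e \<Rightarrow> real" where
  "fnorm v = sqrt (B v v)"

lemma nonneg: "0 \<le> B v v"
  using pos[of v] bilinear_lzero[OF bilinear, of v] by (cases "v = 0") auto

lemma fnorm_nonneg: "0 \<le> fnorm v"
  by (simp add: fnorm_def nonneg)

lemma fnorm_square: "fnorm v * fnorm v = B v v"
  by (simp add: fnorm_def nonneg)

lemma fnorm_eq_0: "fnorm v = 0 \<longleftrightarrow> v = 0"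
  using pos[of v] bilinear_lzero[OF bilinear, of v] by (cases "v = 0") (auto simp: fnorm_def)

lemma fnorm_scaleR: "fnorm (k *\<^sub>R v) = \<bar>k\<bar> * fnorm v"
  by (simp add: fnorm_def bilinear_lmul[OF bilinear] bilinear_rmul[OF bilinear] real_sqrt_mult
      flip: mult.assoc)

lemma Cauchy_Schwarz: "B v w \<le> fnorm v * fnorm w"
proof (cases "v = 0 \<or> w = 0")
  case True
  then show ?thesis
    using bilinear_lzero[OF bilinear, of w] bilinear_rzero[OF bilinear, of v]
    by (auto simp: fnorm_def)
next
  case False
  define m n where "m = fnorm v" and "n = fnorm w"
  have mn: "0 < m" "0 < n"
    using False fnorm_nonneg fnorm_eq_0 by (auto simp: m_def n_def order.strict_iff_order)
  \<comment> \<open>The two vectors are scaled to equal length \<open>m * n\<close>, so that the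
    square becomes a positive multiple of \<open>m * n - B v w\<close>.\<close>
  have "0 \<le> B (n *\<^sub>R v - m *\<^sub>R w) (n *\<^sub>R v - m *\<^sub>R w)"
    by (rule nonneg)
  also have "\<dots> = n * n * B v v - 2 * (m * n) * B v w + m * m * B w w"
    using sym[of w v]
    by (simp add: bilinear_lsub[OF bilinear] bilinear_rsub[OF bilinear] bilinear_lmul[OF bilinear]
        bilinear_rmul[OF bilinear] algebra_simps)
  also have "\<dots> = 2 * (m * n) * (m * n - B v w)"
    by (simp add: m_def n_def algebra_simps flip: fnorm_square)
  finally have "0 \<le> m * n - B v w"
    using mn by (simp only: zero_le_mult_iff) (smt (verit) mult_pos_pos)
  then show ?thesis
    by (simp add: m_def n_def)
qed

lemma fnorm_triangle: "fnorm (v + w) \<le> fnorm v + fnorm w"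
proof -
  have "B (v + w) (v + w) = B v v + 2 * B v w + B w w"
    using sym[of w v] by (simp add: bilinear_ladd[OF bilinear] bilinear_radd[OF bilinear])
  also have "\<dots> \<le> (fnorm v + fnorm w) ^ 2"
    using Cauchy_Schwarz[of v w] by (simp add: power2_eq_square algebra_simps fnorm_square)
  finally show ?thesis
    unfolding fnorm_def[of "v + w"] using fnorm_nonneg by (intro real_le_lsqrt) auto
qed

lemma fnorm_diff_le: "fnorm (v - u) - fnorm (w - u) \<le> fnorm (v - w)"
  using fnorm_triangle[of "v - w" "w - u"] by simp

end

text \<open>Reduces joint continuity in base point and vectors to the finitely many matrix entries,
  since smoothness of the metric is given only for fixed \<open>v\<close> and
  \<open>w\<close>.\<close>

lemma bilinear_expand:
  fixes B :: "'e::euclidean_space \<Rightarrow> 'e \<Rightarrow> real"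
  assumes "bilinear B"
  shows "B v w = (\<Sum>i\<in>Basis. \<Sum>j\<in>Basis. (v \<bullet> i) * (w \<bullet> j) * B i j)"
proof -
  have "B v w = B (\<Sum>i\<in>Basis. (v \<bullet> i) *\<^sub>R i) (\<Sum>j\<in>Basis. (w \<bullet> j) *\<^sub>R j)"
    by (simp add: euclidean_representation)
  also have "\<dots> = (\<Sum>(i, j)\<in>Basis \<times> Basis. B ((v \<bullet> i) *\<^sub>R i) ((w \<bullet> j) *\<^sub>R j))"
    by (rule bilinear_sum[OF assms])
  also have "\<dots> = (\<Sum>i\<in>Basis. \<Sum>j\<in>Basis. (v \<bullet> i) * (w \<bullet> j) * B i j)"
    by (simp add: sum.cartesian_product bilinear_lmul[OF assms] bilinear_rmul[OF assms] mult.left_commute mult.assoc)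
  finally show ?thesis .
qed

section \<open>Riemannian manifolds in charts\<close>

locale riemannian =
  fixes \<A> :: "('m::{t2_space, second_countable_topology}, 'e::euclidean_space) chart set"
    and g :: "('m, 'e) metric_tensor"
  assumes manifold: "riemannian_manifold \<A> g"
begin

abbreviation dom :: "('m, 'e) chart \<Rightarrow> 'm set" where
  "dom c \<equiv> fst c"

abbreviation coord :: "('m, 'e) chart \<Rightarrow> 'm \<Rightarrow> 'e" where
  "coord c \<equiv> snd c"

abbreviation coords :: "('m, 'e) chart \<Rightarrow> 'e set" where
  "coords c \<equiv> snd c ` fst c"

abbreviation pt :: "('m, 'e) chart \<Rightarrow> 'e \<Rightarrow> 'm" where
  "pt c \<equiv> inv_into (fst c) (snd c)"

lemma
  assumes "c \<in> \<A>"
  shows open_dom: "open (dom c)"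
    and open_coords: "open (coords c)"
    and chart_homeomorphism: "homeomorphism (dom c) (coords c) (coord c) (pt c)"
  using assms manifold
  by (auto simp: riemannian_manifold_def smooth_atlas_def is_chart_def split_beta)

lemma continuous_on_coord: "c \<in> \<A> \<Longrightarrow> continuous_on (dom c) (coord c)"
  and continuous_on_pt: "c \<in> \<A> \<Longrightarrow> continuous_on (coords c) (pt c)"
  using chart_homeomorphism by (auto simp: homeomorphism_def)

lemma pt_coord: "c \<in> \<A> \<Longrightarrow> x \<in> dom c \<Longrightarrow> pt c (coord c x) = x"
  using chart_homeomorphism by (auto simp: homeomorphism_def)

lemma coord_pt: "b \<in> coords c \<Longrightarrow> coord c (pt c b) = b"
  by (rule f_inv_into_f)

lemma pt_in_dom: "b \<in> coords c \<Longrightarrow> pt c b \<in> dom c"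
  by (rule inv_into_into)

lemma ex_chart: obtains c where "c \<in> \<A>" "x \<in> dom c"
proof -
  have "x \<in> (\<Union>c\<in>\<A>. dom c)"
    using manifold unfolding riemannian_manifold_def smooth_atlas_def by simp
  then show ?thesis
    using that by blast
qed

lemma open_pt_image:
  assumes "c \<in> \<A>" "open V" "V \<subseteq> coords c"
  shows "open (pt c ` V)"
proof -
  have "openin (top_of_set (dom c)) (pt c ` V)"
    using homeomorphism_imp_open_map[OF homeomorphism_symD[OF chart_homeomorphism[OF assms(1)]]]
      assms(2,3) open_coords[OF assms(1)] by (simp add: openin_open_eq)
  then show ?thesis
    using open_dom[OF assms(1)] by (simp add: openin_open_eq)
qed

lemma open_coord_image:
  assumes "c \<in> \<A>" "open W"
  shows "open (coord c ` (dom c \<inter> W))"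
proof -
  have "openin (top_of_set (dom c)) (dom c \<inter> W)"
    using assms open_dom by (simp add: openin_open_eq open_Int)
  then have "openin (top_of_set (coords c)) (coord c ` (dom c \<inter> W))"
    using homeomorphism_imp_open_map[OF chart_homeomorphism[OF assms(1)]] by blast
  then show ?thesis
    using open_coords[OF assms(1)] by (simp add: openin_open_eq)
qed

lemma
  assumes "c \<in> \<A>" "c' \<in> \<A>"
  shows transition_differentiable:
      "b \<in> coord c ` (dom c \<inter> dom c') \<Longrightarrow> transition c c' differentiable (at b)"
    and transition_derivative_continuous:
      "continuous_on (coord c ` (dom c \<inter> dom c')) (\<lambda>b. frechet_derivative (transition c c') (at b) v)"
proof -
  have "Ck_on (Suc 0) (transition c c') (coord c ` (dom c \<inter> dom c'))"
    using assms manifold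
    unfolding riemannian_manifold_def smooth_atlas_def smooth_on_def by blast
  then show "b \<in> coord c ` (dom c \<inter> dom c') \<Longrightarrow> transition c c' differentiable (at b)"
    "continuous_on (coord c ` (dom c \<inter> dom c')) (\<lambda>b. frechet_derivative (transition c c') (at b) v)"
    by auto
qed

lemma inner_form_metric: "c \<in> \<A> \<Longrightarrow> x \<in> dom c \<Longrightarrow> inner_form (g c x)"
  using manifold unfolding riemannian_manifold_def riemannian_metric_def inner_form_def by blast

lemma metric_compat:
  assumes "c \<in> \<A>" "c' \<in> \<A>" "x \<in> dom c \<inter> dom c'"
  shows "g c x v w = g c' x (frechet_derivative (transition c c') (at (coord c x)) v)
    (frechet_derivative (transition c c') (at (coord c x)) w)"
  using assms manifold unfolding riemannian_manifold_def riemannian_metric_def by blast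

lemma continuous_on_metric_entry: "c \<in> \<A> \<Longrightarrow> continuous_on (coords c) (\<lambda>b. g c (pt c b) v w)"
proof -
  assume "c \<in> \<A>"
  then have "smooth_on (\<lambda>b. g c (pt c b) v w) (coords c)"
    using manifold unfolding riemannian_manifold_def riemannian_metric_def by blast
  then have "Ck_on 0 (\<lambda>b. g c (pt c b) v w) (coords c)"
    unfolding smooth_on_def by blast
  then show ?thesis
    by simp
qed

section \<open>The norm of the metric tensor in coordinates\<close>

definition chart_norm :: "('m, 'e) chart \<Rightarrow> 'e \<Rightarrow> 'e \<Rightarrow> real" where
  "chart_norm c b v = sqrt (g c (pt c b) v v)"

lemma inner_form_pt: "c \<in> \<A> \<Longrightarrow> b \<in> coords c \<Longrightarrow> inner_form (g c (pt c b))"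
  by (intro inner_form_metric pt_in_dom)

lemma chart_norm_eq: "c \<in> \<A> \<Longrightarrow> b \<in> coords c \<Longrightarrow> chart_norm c b = inner_form.fnorm (g c (pt c b))"
  by (rule ext) (simp add: chart_norm_def inner_form.fnorm_def[OF inner_form_pt])

lemma continuous_on_chart_norm:
  fixes \<beta> v :: "'x::topological_space \<Rightarrow> 'e"
  assumes "c \<in> \<A>" "continuous_on T \<beta>" "continuous_on T v" "\<beta> ` T \<subseteq> coords c"
  shows "continuous_on T (\<lambda>t. chart_norm c (\<beta> t) (v t))"
proof -
  have entry: "continuous_on T (\<lambda>t. g c (pt c (\<beta> t)) i j)" for i j
    using continuous_on_compose2[OF continuous_on_metric_entry[OF assms(1)] assms(2,4)] .
  have "continuous_on T (\<lambda>t. \<Sum>i\<in>Basis. \<Sum>j\<in>Basis. (v t \<bullet> i) * (v t \<bullet> j) * g c (pt c (\<beta> t)) i j)"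
    by (intro continuous_intros entry assms)
  moreover have "g c (pt c (\<beta> t)) (v t) (v t) =
      (\<Sum>i\<in>Basis. \<Sum>j\<in>Basis. (v t \<bullet> i) * (v t \<bullet> j) * g c (pt c (\<beta> t)) i j)" if "t \<in> T" for t
    using that assms by (intro bilinear_expand inner_form.bilinear inner_form_pt) auto
  ultimately have "continuous_on T (\<lambda>t. g c (pt c (\<beta> t)) (v t) (v t))"
    by (simp cong: continuous_on_cong)
  then show ?thesis
    unfolding chart_norm_def by (intro continuous_intros)
qed

lemma chart_norm_scaleR: "c \<in> \<A> \<Longrightarrow> b \<in> coords c \<Longrightarrow> chart_norm c b (k *\<^sub>R v) = \<bar>k\<bar> * chart_norm c b v"
  by (simp add: chart_norm_eq inner_form.fnorm_scaleR inner_form_pt)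

lemma chart_norm_nonneg: "c \<in> \<A> \<Longrightarrow> b \<in> coords c \<Longrightarrow> 0 \<le> chart_norm c b v"
  by (simp add: chart_norm_eq inner_form.fnorm_nonneg inner_form_pt)

lemma chart_norm_pos: "c \<in> \<A> \<Longrightarrow> b \<in> coords c \<Longrightarrow> v \<noteq> 0 \<Longrightarrow> 0 < chart_norm c b v"
  using chart_norm_nonneg[of c b v]
  by (simp add: chart_norm_eq inner_form.fnorm_eq_0 inner_form_pt order.strict_iff_order)

text \<open>Homogeneity of both sides; it lets compactness of the unit sphere control all
  vectors.\<close>

lemma chart_norm_from_sphere:
  assumes c: "c \<in> \<A>" "b \<in> coords c" "b' \<in> coords c"
    and sphere: "\<And>v. norm v = 1 \<Longrightarrow> chart_norm c b v \<le> k * chart_norm c b' v"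
  shows "chart_norm c b v \<le> k * chart_norm c b' v"
proof (cases "v = 0")
  case True
  then show ?thesis
    using chart_norm_scaleR[OF c(1,2), of 0 v] chart_norm_scaleR[OF c(1,3), of 0 v] by simp
next
  case False
  have "chart_norm c b (norm v *\<^sub>R sgn v) \<le> k * chart_norm c b' (norm v *\<^sub>R sgn v)"
    using sphere[of "sgn v"] False c by (simp add: chart_norm_scaleR norm_sgn mult_left_mono)
  then show ?thesis
    using False by (simp add: sgn_div_norm)
qed

text \<open>The constants are the extrema over the compact unit sphere, and definiteness makes the
  minimum positive.\<close>

lemma chart_norm_equivalent:
  assumes c: "c \<in> \<A>" "a \<in> coords c"
  obtains m M where "0 < m" "0 < M" "\<And>v. m * norm v \<le> chart_norm c a v"
    "\<And>v. chart_norm c a v \<le> M * norm v"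
proof -
  have cont: "continuous_on (sphere 0 1) (chart_norm c a)"
    by (intro continuous_on_chart_norm continuous_intros) (use c in auto)
  have ne: "sphere (0::'e) 1 \<noteq> {}"
    by simp
  obtain u where u: "norm u = 1" "\<And>v. norm v = 1 \<Longrightarrow> chart_norm c a u \<le> chart_norm c a v"
    using continuous_attains_inf[OF compact_sphere ne cont] by auto
  obtain w where w: "norm w = 1" "\<And>v. norm v = 1 \<Longrightarrow> chart_norm c a v \<le> chart_norm c a w"
    using continuous_attains_sup[OF compact_sphere ne cont] by auto
  have scale: "chart_norm c a v = norm v * chart_norm c a (sgn v)" for v
    using chart_norm_scaleR[OF c, of "norm v" "sgn v"] by (cases "v = 0") (auto simp: sgn_div_norm)
  show ?thesis
  proof
    show "0 < chart_norm c a u" "0 < chart_norm c a w"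
      using u(1) w(1) c by (auto intro!: chart_norm_pos)
    show "chart_norm c a u * norm v \<le> chart_norm c a v" for v
      using u(2)[of "sgn v"] scale[of v]
      by (cases "v = 0") (auto simp: norm_sgn mult.commute mult_left_mono)
    show "chart_norm c a v \<le> chart_norm c a w * norm v" for v
      using w(2)[of "sgn v"] scale[of v]
      by (cases "v = 0") (auto simp: norm_sgn mult.commute mult_left_mono)
  qed
qed

lemma chart_norm_nearly_constant:
  assumes c: "c \<in> \<A>" "a \<in> coords c" and "0 < \<eta>"
  obtains r where "0 < r" "ball a r \<subseteq> coords c"
    "\<And>b v. b \<in> ball a r \<Longrightarrow> chart_norm c b v \<le> (1 + \<eta>) * chart_norm c a v"
    "\<And>b v. b \<in> ball a r \<Longrightarrow> chart_norm c a v \<le> (1 + \<eta>) * chart_norm c b v"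
proof -
  obtain m M where m: "0 < m" "\<And>v. m * norm v \<le> chart_norm c a v"
    using chart_norm_equivalent[OF c] by metis
  obtain r0 where r0: "0 < r0" "cball a r0 \<subseteq> coords c"
    using open_coords[OF c(1)] c(2) open_contains_cball by blast
  let ?S = "cball a r0 \<times> sphere (0::'e) 1"
  define \<delta> where "\<delta> = m * \<eta> / (1 + \<eta>)"
  have "0 < \<delta>"
    using m \<open>0 < \<eta>\<close> by (simp add: \<delta>_def)
  have "(1 + \<eta>) * \<delta> = m * \<eta>"
    using \<open>0 < \<eta>\<close> by (simp add: \<delta>_def)
  have "continuous_on ?S (\<lambda>bv. chart_norm c (fst bv) (snd bv))"
    by (intro continuous_on_chart_norm continuous_intros c) (use r0 in auto)
  then have "uniformly_continuous_on ?S (\<lambda>bv. chart_norm c (fst bv) (snd bv))"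
    by (intro compact_uniformly_continuous compact_Times compact_cball compact_sphere)
  then obtain r1 where r1: "0 < r1" "\<And>x y. x \<in> ?S \<Longrightarrow> y \<in> ?S \<Longrightarrow> dist y x < r1 \<Longrightarrow>
      dist (chart_norm c (fst y) (snd y)) (chart_norm c (fst x) (snd x)) < \<delta>"
    unfolding uniformly_continuous_on_def using \<open>0 < \<delta>\<close> by metis
  define r where "r = min r0 r1"
  have near: "\<bar>chart_norm c b v - chart_norm c a v\<bar> < \<delta>" if "b \<in> ball a r" "norm v = 1" for b v
    using r1(2)[of "(a, v)" "(b, v)"] that r0
    by (auto simp: r_def dist_Pair_Pair dist_real_def dist_commute)
  have in_coords: "b \<in> coords c" if "b \<in> ball a r" for b
    using that r0 by (auto simp: r_def)
  show ?thesis
  proof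
    show "0 < r"
      using r0 r1 by (simp add: r_def)
    show "ball a r \<subseteq> coords c"
      using in_coords by blast
  next
    fix b v assume b: "b \<in> ball a r"
    show "chart_norm c b v \<le> (1 + \<eta>) * chart_norm c a v"
    proof (rule chart_norm_from_sphere)
      fix v :: 'e assume v: "norm v = 1"
      have "\<delta> \<le> m * \<eta>"
        using \<open>(1 + \<eta>) * \<delta> = m * \<eta>\<close> \<open>0 < \<delta>\<close> \<open>0 < \<eta>\<close> mult_pos_pos[of \<eta> \<delta>]
        unfolding distrib_right by linarith
      also have "\<dots> \<le> chart_norm c a v * \<eta>"
        using m(2)[of v] v \<open>0 < \<eta>\<close> by simp
      finally show "chart_norm c b v \<le> (1 + \<eta>) * chart_norm c a v"
        using near[OF b v] by (simp add: algebra_simps)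
    qed (use c b in_coords in auto)
    show "chart_norm c a v \<le> (1 + \<eta>) * chart_norm c b v"
    proof (rule chart_norm_from_sphere)
      fix v :: 'e assume v: "norm v = 1"
      have "(1 + \<eta>) * (chart_norm c a v - \<delta>) \<le> (1 + \<eta>) * chart_norm c b v"
        using near[OF b v] \<open>0 < \<eta>\<close> by (intro mult_left_mono) auto
      moreover have "m * \<eta> \<le> chart_norm c a v * \<eta>"
        using m(2)[of v] v \<open>0 < \<eta>\<close> by simp
      ultimately show "chart_norm c a v \<le> (1 + \<eta>) * chart_norm c b v"
        using \<open>(1 + \<eta>) * \<delta> = m * \<eta>\<close> by (simp add: algebra_simps)
    qed (use c b in_coords in auto)
  qed
qed

section \<open>Length of curves\<close>

text \<open>The chain rule for the transition map. Coordinates are meaningless off the chart domain,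
  so the composite agrees with \<open>coord c' \<circ> \<gamma>\<close> only near \<open>t\<close>,
  where continuity keeps the curve in \<open>dom c\<close>.\<close>

lemma has_vector_derivative_change_chart:
  assumes c: "c \<in> \<A>" "c' \<in> \<A>" and t: "t \<in> S" "\<gamma> t \<in> dom c" "\<gamma> t \<in> dom c'"
    and cont: "continuous (at t within S) \<gamma>"
    and v: "(coord c \<circ> \<gamma> has_vector_derivative v) (at t within S)"
  shows "(coord c' \<circ> \<gamma> has_vector_derivative
    frechet_derivative (transition c c') (at (coord c (\<gamma> t))) v) (at t within S)"
proof -
  let ?T = "transition c c'" and ?b = "coord c (\<gamma> t)"
  have "?T differentiable at ?b"
    by (rule transition_differentiable) (use c t in auto)
  then have "(?T has_derivative frechet_derivative ?T (at ?b)) (at ?b within (coord c \<circ> \<gamma>) ` S)"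
    by (simp add: frechet_derivative_works has_derivative_at_withinI)
  then have "(?T \<circ> (coord c \<circ> \<gamma>) has_vector_derivative frechet_derivative ?T (at ?b) v) (at t within S)"
    using vector_derivative_diff_chain_within[OF v] by simp
  moreover have "\<forall>\<^sub>F s in at t within S. \<gamma> s \<in> dom c"
    using topological_tendstoD[OF cont[unfolded continuous_within] open_dom[OF c(1)] t(2)] .
  then have "\<forall>\<^sub>F s in at t within S. (?T \<circ> (coord c \<circ> \<gamma>)) s = (coord c' \<circ> \<gamma>) s"
    by eventually_elim (simp add: transition_def pt_coord[OF c(1)])
  moreover have "(?T \<circ> (coord c \<circ> \<gamma>)) t = (coord c' \<circ> \<gamma>) t"
    using t by (simp add: transition_def pt_coord[OF c(1)])
  ultimately show ?thesis
    using t(1) unfolding has_vector_derivative_def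
    by (blast intro: has_derivative_transform_eventually)
qed

text \<open>Frees the speed from the chart picked by \<open>SOME\<close>: the velocity transforms by
  the derivative of the transition map, and \<open>metric_compat\<close> makes the two norms
  equal.\<close>

lemma curve_speed_eq:
  assumes c: "c \<in> \<A>" "\<gamma> t \<in> dom c" and cont: "isCont \<gamma> t"
    and v: "(coord c \<circ> \<gamma> has_vector_derivative v) (at t)"
  shows "curve_speed \<A> g \<gamma> t = chart_norm c (coord c (\<gamma> t)) v"
proof -
  define c' where "c' = (SOME c. c \<in> \<A> \<and> \<gamma> t \<in> dom c)"
  have "\<exists>c. c \<in> \<A> \<and> \<gamma> t \<in> dom c"
    using c by blast
  then have c': "c' \<in> \<A>" "\<gamma> t \<in> dom c'"
    unfolding c'_def by (metis (mono_tags, lifting) someI_ex)+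
  let ?w = "frechet_derivative (transition c c') (at (coord c (\<gamma> t))) v"
  have "(coord c' \<circ> \<gamma> has_vector_derivative ?w) (at t)"
    by (rule has_vector_derivative_change_chart) (use c c' cont v in auto)
  then have "curve_speed \<A> g \<gamma> t = sqrt (g c' (\<gamma> t) ?w ?w)"
    by (simp add: curve_speed_def Let_def vector_derivative_at flip: c'_def)
  also have "g c' (\<gamma> t) ?w ?w = g c (\<gamma> t) v v"
    using metric_compat[OF c(1) c'(1)] c(2) c'(2) by (metis IntI)
  finally show ?thesis
    using c by (simp add: chart_norm_def pt_coord)
qed

lemma curve_speed_nonneg: "0 \<le> curve_speed \<A> g \<gamma> t"
proof -
  define c where "c = (SOME c. c \<in> \<A> \<and> \<gamma> t \<in> dom c)"
  have "\<exists>c. c \<in> \<A> \<and> \<gamma> t \<in> dom c"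
    using ex_chart by blast
  then have "c \<in> \<A>" "\<gamma> t \<in> dom c"
    unfolding c_def by (metis (mono_tags, lifting) someI_ex)+
  then show ?thesis
    using inner_form.nonneg[OF inner_form_metric]
    by (simp add: curve_speed_def Let_def flip: c_def)
qed

text \<open>Also true where the speed is not integrable, as the integral is then 0 by
  default.\<close>

lemma integral_curve_speed_nonneg: "0 \<le> integral S (curve_speed \<A> g \<gamma>)"
  by (cases "curve_speed \<A> g \<gamma> integrable_on S")
    (auto simp: integral_nonneg curve_speed_nonneg not_integrable_integral)

text \<open>The speed formula is restricted to interior times because \<open>curve_speed\<close>
  takes the two-sided derivative, while a piece of the curve has only one-sided derivatives at its
  ends.\<close>

lemma C1_curve_chart:
  assumes \<gamma>: "C1_curve_on \<A> a b \<gamma>" and st: "a \<le> s" "t \<le> b"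
    and c: "c \<in> \<A>" "\<gamma> ` {s..t} \<subseteq> dom c"
  obtains v where
    "\<And>\<tau>. \<tau> \<in> {s..t} \<Longrightarrow> (coord c \<circ> \<gamma> has_vector_derivative v \<tau>) (at \<tau> within {s..t})"
    "continuous_on {s..t} (\<lambda>\<tau>. chart_norm c (coord c (\<gamma> \<tau>)) (v \<tau>))"
    "\<And>\<tau>. \<tau> \<in> {s<..<t} \<Longrightarrow> curve_speed \<A> g \<gamma> \<tau> = chart_norm c (coord c (\<gamma> \<tau>)) (v \<tau>)"
proof -
  have cont: "continuous_on {a..b} \<gamma>"
    using \<gamma> by (simp add: C1_curve_on_def)
  obtain v where v: "continuous_on {\<tau>\<in>{a..b}. \<gamma> \<tau> \<in> dom c} v"
    "\<And>\<tau>. \<tau> \<in> {a..b} \<Longrightarrow> \<gamma> \<tau> \<in> dom c \<Longrightarrow> (coord c \<circ> \<gamma> has_vector_derivative v \<tau>) (at \<tau> within {a..b})"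
    using \<gamma> c(1) by (fastforce simp: C1_curve_on_def split_beta)
  have sub: "{s..t} \<subseteq> {\<tau>\<in>{a..b}. \<gamma> \<tau> \<in> dom c}"
    using st c(2) by auto
  have cont_st: "continuous_on {s..t} \<gamma>"
    using st by (auto intro: continuous_on_subset[OF cont])
  show ?thesis
  proof
    show "(coord c \<circ> \<gamma> has_vector_derivative v \<tau>) (at \<tau> within {s..t})" if "\<tau> \<in> {s..t}" for \<tau>
      using has_vector_derivative_within_subset[OF v(2)] that sub by blast
    have "continuous_on {s..t} (\<lambda>\<tau>. coord c (\<gamma> \<tau>))"
      using continuous_on_compose2[OF continuous_on_coord[OF c(1)] cont_st c(2)] .
    then show "continuous_on {s..t} (\<lambda>\<tau>. chart_norm c (coord c (\<gamma> \<tau>)) (v \<tau>))"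
      using continuous_on_subset[OF v(1) sub] c by (intro continuous_on_chart_norm) auto
    show "curve_speed \<A> g \<gamma> \<tau> = chart_norm c (coord c (\<gamma> \<tau>)) (v \<tau>)" if "\<tau> \<in> {s<..<t}" for \<tau>
    proof (rule curve_speed_eq)
      have at: "at \<tau> within {a..b} = at \<tau>"
        using that st by (intro at_within_Icc_at) auto
      show "isCont \<gamma> \<tau>"
        using cont[unfolded continuous_on_eq_continuous_within, rule_format, of \<tau>] that st at by simp
      show "(coord c \<circ> \<gamma> has_vector_derivative v \<tau>) (at \<tau>)"
      proof -
        have "\<tau> \<in> {s..t}"
          using that by auto
        then have "\<tau> \<in> {a..b}" "\<gamma> \<tau> \<in> dom c"
          using sub by blast+
        then show ?thesis
          using v(2)[of \<tau>] at by simp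
      qed
      show "\<gamma> \<tau> \<in> dom c"
        using that c by auto
    qed (rule c)
  qed
qed

lemma curve_speed_integrable_in_chart:
  assumes "C1_curve_on \<A> a b \<gamma>" "a \<le> s" "t \<le> b" "c \<in> \<A>" "\<gamma> ` {s..t} \<subseteq> dom c"
  shows "curve_speed \<A> g \<gamma> integrable_on {s..t}"
proof -
  obtain v where
    "\<And>\<tau>. \<tau> \<in> {s..t} \<Longrightarrow> (coord c \<circ> \<gamma> has_vector_derivative v \<tau>) (at \<tau> within {s..t})"
    and cont: "continuous_on {s..t} (\<lambda>\<tau>. chart_norm c (coord c (\<gamma> \<tau>)) (v \<tau>))"
    and speed: "\<And>\<tau>. \<tau> \<in> {s<..<t} \<Longrightarrow> curve_speed \<A> g \<gamma> \<tau> = chart_norm c (coord c (\<gamma> \<tau>)) (v \<tau>)"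
    by (rule C1_curve_chart[OF assms]) (rule that; simp)
  from cont have "(\<lambda>\<tau>. chart_norm c (coord c (\<gamma> \<tau>)) (v \<tau>)) integrable_on {s..t}"
    by (intro integrable_continuous_interval)
  then show ?thesis
    by (rule integrable_spike_finite[where S = "{s, t}", rotated 2]) (auto intro: speed)
qed

text \<open>Continuity, put into the local form that interval bisection by \<open>Bolzano\<close>
  asks for.\<close>

lemma C1_curve_near:
  assumes "C1_curve_on \<A> a b \<gamma>" "x \<in> {a..b}" "open V" "\<gamma> x \<in> V"
  shows "\<exists>\<delta>>0. \<forall>s t. a \<le> s \<and> s \<le> x \<and> x \<le> t \<and> t \<le> b \<and> t - s < \<delta> \<longrightarrow> \<gamma> ` {s..t} \<subseteq> V"
proof -
  have "continuous (at x within {a..b}) \<gamma>"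
    using assms(1,2) by (auto simp: C1_curve_on_def continuous_on_eq_continuous_within)
  then have "\<forall>\<^sub>F \<tau> in at x within {a..b}. \<gamma> \<tau> \<in> V"
    using assms(3,4) unfolding continuous_within by (rule topological_tendstoD)
  then obtain \<delta> where \<delta>: "0 < \<delta>"
    "\<And>\<tau>. \<tau> \<in> {a..b} \<Longrightarrow> \<tau> \<noteq> x \<Longrightarrow> dist \<tau> x < \<delta> \<Longrightarrow> \<gamma> \<tau> \<in> V"
    unfolding eventually_at by blast
  show ?thesis
  proof (intro exI[of _ \<delta>] conjI allI impI)
    fix s t assume st: "a \<le> s \<and> s \<le> x \<and> x \<le> t \<and> t \<le> b \<and> t - s < \<delta>"
    show "\<gamma> ` {s..t} \<subseteq> V"
    proof
      fix y assume "y \<in> \<gamma> ` {s..t}"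
      then obtain \<tau> where "\<tau> \<in> {s..t}" "y = \<gamma> \<tau>"
        by blast
      then show "y \<in> V"
        using \<delta>(2)[of \<tau>] assms(4) st by (cases "\<tau> = x") (auto simp: dist_real_def)
    qed
  qed (rule \<delta>)
qed

text \<open>Integrability survives concatenation of intervals and holds on intervals so short that
  the curve stays in one chart; bisection gives the rest.\<close>

lemma C1_curve_speed_integrable:
  assumes \<gamma>: "C1_curve_on \<A> a b \<gamma>" and "a \<le> b"
  shows "curve_speed \<A> g \<gamma> integrable_on {a..b}"
proof -
  define P where "P s t \<longleftrightarrow> (a \<le> s \<and> s \<le> t \<and> t \<le> b \<longrightarrow> curve_speed \<A> g \<gamma> integrable_on {s..t})" for s t
  from \<open>a \<le> b\<close> have "P a b"
  proof (induction rule: Bolzano)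
    case (trans s x t)
    then show ?case
      unfolding P_def by (meson Henstock_Kurzweil_Integration.integrable_combine order_trans)
  next
    case (local x)
    obtain c where c: "c \<in> \<A>" "\<gamma> x \<in> dom c"
      by (rule ex_chart)
    have "x \<in> {a..b}"
      using local by simp
    from C1_curve_near[OF \<gamma> this open_dom[OF c(1)] c(2)]
    obtain \<delta> where \<delta>: "0 < \<delta>" "\<forall>s t. a \<le> s \<and> s \<le> x \<and> x \<le> t \<and> t \<le> b \<and> t - s < \<delta> \<longrightarrow> \<gamma> ` {s..t} \<subseteq> dom c"
      by blast
    show ?case
    proof (intro exI[of _ \<delta>] conjI allI impI)
      fix s t assume st: "s \<le> x \<and> x \<le> t \<and> t - s < \<delta>"
      show "P s t"
        unfolding P_def using \<delta>(2) st by (blast intro: curve_speed_integrable_in_chart[OF \<gamma> _ _ c(1)])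
    qed (rule \<delta>)
  qed
  then show ?thesis
    using \<open>a \<le> b\<close> by (simp add: P_def)
qed

text \<open>Increments of \<open>f\<close> and integrals of the speed are both additive over
  adjacent intervals, so an estimate on short intervals propagates by bisection.\<close>

lemma C1_curve_increment_le:
  fixes f :: "real \<Rightarrow> real"
  assumes \<gamma>: "C1_curve_on \<A> a b \<gamma>" and "a \<le> b"
    and local: "\<And>x. x \<in> {a..b} \<Longrightarrow> \<exists>\<delta>>0. \<forall>s t. a \<le> s \<and> s \<le> x \<and> x \<le> t \<and> t \<le> b \<and> t - s < \<delta> \<longrightarrow>
      f t - f s \<le> C * integral {s..t} (curve_speed \<A> g \<gamma>)"
  shows "f b - f a \<le> C * integral {a..b} (curve_speed \<A> g \<gamma>)"
proof -
  define P where "P s t \<longleftrightarrow> (a \<le> s \<and> s \<le> t \<and> t \<le> b \<longrightarrow>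
    f t - f s \<le> C * integral {s..t} (curve_speed \<A> g \<gamma>))" for s t
  from \<open>a \<le> b\<close> have "P a b"
  proof (induction rule: Bolzano)
    case (trans s x t)
    show ?case
      unfolding P_def
    proof
      assume st: "a \<le> s \<and> s \<le> t \<and> t \<le> b"
      have "curve_speed \<A> g \<gamma> integrable_on {s..t}"
        using C1_curve_speed_integrable[OF \<gamma> \<open>a \<le> b\<close>] st by (auto intro: integrable_subinterval_real)
      then have "integral {s..x} (curve_speed \<A> g \<gamma>) + integral {x..t} (curve_speed \<A> g \<gamma>)
          = integral {s..t} (curve_speed \<A> g \<gamma>)"
        using trans by (intro Henstock_Kurzweil_Integration.integral_combine) auto
      then have "C * integral {s..t} (curve_speed \<A> g \<gamma>)
          = C * integral {s..x} (curve_speed \<A> g \<gamma>) + C * integral {x..t} (curve_speed \<A> g \<gamma>)"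
        by (simp flip: distrib_left)
      moreover have "f x - f s \<le> C * integral {s..x} (curve_speed \<A> g \<gamma>)"
        "f t - f x \<le> C * integral {x..t} (curve_speed \<A> g \<gamma>)"
        using trans st unfolding P_def by auto
      ultimately show "f t - f s \<le> C * integral {s..t} (curve_speed \<A> g \<gamma>)"
        by linarith
    qed
  next
    case (local x)
    then obtain \<delta> where "0 < \<delta>" "\<And>s t. a \<le> s \<and> s \<le> x \<and> x \<le> t \<and> t \<le> b \<and> t - s < \<delta> \<Longrightarrow>
        f t - f s \<le> C * integral {s..t} (curve_speed \<A> g \<gamma>)"
      using assms(3)[of x] by auto
    then show ?case
      unfolding P_def by blast
  qed
  then show ?thesis
    using \<open>a \<le> b\<close> by (simp add: P_def)
qed

lemma piecewise_C1_curve_increment_le: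
  fixes f :: "real \<Rightarrow> real"
  assumes \<gamma>: "piecewise_C1_curve \<A> \<gamma>"
    and local: "\<And>a b x. C1_curve_on \<A> a b \<gamma> \<Longrightarrow> x \<in> {a..b} \<Longrightarrow>
      \<exists>\<delta>>0. \<forall>s t. a \<le> s \<and> s \<le> x \<and> x \<le> t \<and> t \<le> b \<and> t - s < \<delta> \<longrightarrow>
      f t - f s \<le> C * integral {s..t} (curve_speed \<A> g \<gamma>)"
  shows "f 1 - f 0 \<le> C * curve_length \<A> g \<gamma>"
proof -
  obtain n \<tau> where \<tau>: "\<tau> 0 = 0" "\<tau> n = 1"
    "\<And>i. i < n \<Longrightarrow> \<tau> i < \<tau> (Suc i) \<and> C1_curve_on \<A> (\<tau> i) (\<tau> (Suc i)) \<gamma>"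
    using \<gamma> by (auto simp: piecewise_C1_curve_def)
  \<comment> \<open>The induction over break points carries \<open>0 \<le> \<tau> i\<close> and
    integrability along, since splitting the integral requires them.\<close>
  let ?s = "curve_speed \<A> g \<gamma>"
  have "0 \<le> \<tau> i \<and> ?s integrable_on {0..\<tau> i} \<and> f (\<tau> i) - f 0 \<le> C * integral {0..\<tau> i} ?s"
    if "i \<le> n" for i
    using that
  proof (induction i)
    case 0
    then show ?case
      using integrable_on_refl[of "?s" 0] by (simp add: \<tau>)
  next
    case (Suc i)
    then have IH: "0 \<le> \<tau> i" "?s integrable_on {0..\<tau> i}" "f (\<tau> i) - f 0 \<le> C * integral {0..\<tau> i} ?s"
      and piece: "\<tau> i \<le> \<tau> (Suc i)" "C1_curve_on \<A> (\<tau> i) (\<tau> (Suc i)) \<gamma>"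
      using \<tau>(3)[of i] by auto
    have "?s integrable_on {\<tau> i..\<tau> (Suc i)}"
      by (rule C1_curve_speed_integrable[OF piece(2,1)])
    then have int: "?s integrable_on {0..\<tau> (Suc i)}"
      using IH piece(1) by (blast intro: Henstock_Kurzweil_Integration.integrable_combine)
    have "integral {0..\<tau> i} ?s + integral {\<tau> i..\<tau> (Suc i)} ?s = integral {0..\<tau> (Suc i)} ?s"
      using IH piece(1) int by (intro Henstock_Kurzweil_Integration.integral_combine) auto
    then have "C * integral {0..\<tau> (Suc i)} ?s
        = C * integral {0..\<tau> i} ?s + C * integral {\<tau> i..\<tau> (Suc i)} ?s"
      by (simp flip: distrib_left)
    moreover have "f (\<tau> (Suc i)) - f (\<tau> i) \<le> C * integral {\<tau> i..\<tau> (Suc i)} ?s"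
      by (rule C1_curve_increment_le[OF piece(2,1)]) (rule local[OF piece(2)])
    ultimately have "f (\<tau> (Suc i)) - f 0 \<le> C * integral {0..\<tau> (Suc i)} ?s"
      using IH(3) by linarith
    then show ?case
      using IH piece int by auto
  qed
  from this[of n] show ?thesis
    by (simp add: \<tau> curve_length_def)
qed

lemma chart_norm_increment_le:
  assumes \<gamma>: "C1_curve_on \<A> a' b' \<gamma>" and st: "a' \<le> s" "s \<le> t" "t \<le> b'"
    and c: "c \<in> \<A>" "a \<in> coords c" "\<gamma> ` {s..t} \<subseteq> dom c" and "0 \<le> C"
    and le: "\<And>\<tau> v. \<tau> \<in> {s..t} \<Longrightarrow> chart_norm c a v \<le> C * chart_norm c (coord c (\<gamma> \<tau>)) v"
  shows "chart_norm c a (coord c (\<gamma> t) - coord c (\<gamma> s)) \<le> C * integral {s..t} (curve_speed \<A> g \<gamma>)"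
proof -
  interpret inner_form "g c (pt c a)"
    by (rule inner_form_pt) (use c in auto)
  have N: "chart_norm c a = fnorm"
    by (rule chart_norm_eq) (use c in auto)
  define \<Delta> where "\<Delta> = coord c (\<gamma> t) - coord c (\<gamma> s)"
  show ?thesis
  proof (cases "\<Delta> = 0")
    case True
    then show ?thesis
      using integral_curve_speed_nonneg \<open>0 \<le> C\<close> fnorm_eq_0[of 0] by (simp add: N flip: \<Delta>_def)
  next
    case False
    then have pos: "0 < fnorm \<Delta>"
      using fnorm_eq_0 fnorm_nonneg by (simp add: order.strict_iff_order)
    obtain v where v:
      "\<And>\<tau>. \<tau> \<in> {s..t} \<Longrightarrow> (coord c \<circ> \<gamma> has_vector_derivative v \<tau>) (at \<tau> within {s..t})"
      "continuous_on {s..t} (\<lambda>\<tau>. chart_norm c (coord c (\<gamma> \<tau>)) (v \<tau>))"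
      "\<And>\<tau>. \<tau> \<in> {s<..<t} \<Longrightarrow> curve_speed \<A> g \<gamma> \<tau> = chart_norm c (coord c (\<gamma> \<tau>)) (v \<tau>)"
      by (rule C1_curve_chart[OF \<gamma> st(1,3) c(1,3)]) (rule that; simp)
    have "(v has_integral \<Delta>) {s..t}"
      using fundamental_theorem_of_calculus[OF st(2) v(1)] by (simp add: \<Delta>_def)
    moreover have "bounded_linear (\<lambda>w. g c (pt c a) w \<Delta>)"
      using bilinear by (simp add: bilinear_def linear_conv_bounded_linear)
    ultimately have "((\<lambda>w. g c (pt c a) w \<Delta>) \<circ> v has_integral g c (pt c a) \<Delta> \<Delta>) {s..t}"
      by (rule has_integral_linear)
    then have int_lhs: "((\<lambda>\<tau>. g c (pt c a) (v \<tau>) \<Delta>) has_integral g c (pt c a) \<Delta> \<Delta>) {s..t}"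
      by (simp only: o_def)
    have "(curve_speed \<A> g \<gamma> has_integral integral {s..t} (curve_speed \<A> g \<gamma>)) {s..t}"
      using curve_speed_integrable_in_chart[OF \<gamma> st(1,3) c(1,3)] by (simp add: integrable_integral)
    then have int_rhs: "((\<lambda>\<tau>. C * fnorm \<Delta> * curve_speed \<A> g \<gamma> \<tau>)
        has_integral (C * fnorm \<Delta> * integral {s..t} (curve_speed \<A> g \<gamma>))) {s..t}"
      by (rule has_integral_mult_right)
    have "g c (pt c a) \<Delta> \<Delta> \<le> C * fnorm \<Delta> * integral {s..t} (curve_speed \<A> g \<gamma>)"
    proof (rule has_integral_le[OF has_integral_spike_finite[where S = "{s, t}", OF _ _ int_lhs]
          has_integral_spike_finite[where S = "{s, t}", OF _ _ int_rhs]])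
      \<comment> \<open>Both integrands are set to 0 at the end points, where the speed is not
        controlled.\<close>
      let ?f = "\<lambda>h \<tau>. if \<tau> \<in> {s, t} then 0 else h \<tau>"
      show "?f (\<lambda>\<tau>. g c (pt c a) (v \<tau>) \<Delta>) \<tau> = g c (pt c a) (v \<tau>) \<Delta>" if "\<tau> \<in> {s..t} - {s, t}" for \<tau>
        using that by simp
      show "?f (\<lambda>\<tau>. C * fnorm \<Delta> * curve_speed \<A> g \<gamma> \<tau>) \<tau> = C * fnorm \<Delta> * curve_speed \<A> g \<gamma> \<tau>"
        if "\<tau> \<in> {s..t} - {s, t}" for \<tau>
        using that by simp
      fix \<tau> assume \<tau>: "\<tau> \<in> {s..t}"
      show "?f (\<lambda>\<tau>. g c (pt c a) (v \<tau>) \<Delta>) \<tau> \<le> ?f (\<lambda>\<tau>. C * fnorm \<Delta> * curve_speed \<A> g \<gamma> \<tau>) \<tau>"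
      proof (cases "\<tau> \<in> {s, t}")
        case False
        have "g c (pt c a) (v \<tau>) \<Delta> \<le> fnorm (v \<tau>) * fnorm \<Delta>"
          by (rule Cauchy_Schwarz)
        also have "\<dots> \<le> C * chart_norm c (coord c (\<gamma> \<tau>)) (v \<tau>) * fnorm \<Delta>"
          using le[OF \<tau>] pos by (simp add: N)
        also have "\<dots> = C * fnorm \<Delta> * curve_speed \<A> g \<gamma> \<tau>"
          using v(3)[of \<tau>] False \<tau> by simp
        finally show ?thesis
          using False by simp
      qed simp
    qed auto
    then have "fnorm \<Delta> * fnorm \<Delta> \<le> fnorm \<Delta> * (C * integral {s..t} (curve_speed \<A> g \<gamma>))"
      by (simp add: fnorm_square mult_ac)
    then show ?thesis
      using pos by (simp add: N flip: \<Delta>_def)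
  qed
qed

section \<open>Comparison of the Riemannian distance with the chart norm\<close>

text \<open>Coordinate segments are the competitors for all upper bounds on the distance, and they
  show that some curve joins two points of a chart ball.\<close>

lemma segment_curve:
  fixes b b' :: 'e
  assumes c: "c \<in> \<A>" and seg: "closed_segment b b' \<subseteq> coords c"
  defines "\<gamma> \<equiv> \<lambda>t. pt c (b + t *\<^sub>R (b' - b))"
  shows "piecewise_C1_curve \<A> \<gamma>"
    and "curve_length \<A> g \<gamma> = integral {0..1} (\<lambda>t. chart_norm c (b + t *\<^sub>R (b' - b)) (b' - b))"
proof -
  define \<Delta> l where "\<Delta> = b' - b" and "l t = b + t *\<^sub>R \<Delta>" for t
  have \<gamma>: "\<gamma> t = pt c (l t)" for t
    by (simp add: \<gamma>_def l_def \<Delta>_def)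
  have l_seg: "l t \<in> closed_segment b b'" if "t \<in> {0..1}" for t
    unfolding in_segment using that by (intro exI[of _ t]) (auto simp: l_def \<Delta>_def algebra_simps)
  then have l: "l t \<in> coords c" if "t \<in> {0..1}" for t
    using seg that by blast
  then have dom: "\<gamma> t \<in> dom c" and coord: "coord c (\<gamma> t) = l t" if "t \<in> {0..1}" for t
    using that by (simp_all only: \<gamma> pt_in_dom coord_pt)
  have cont_l: "continuous_on S l" for S
    unfolding l_def by (intro continuous_intros)
  have cont: "continuous_on {0..1} \<gamma>"
    unfolding \<gamma> by (rule continuous_on_compose2[OF continuous_on_pt[OF c] cont_l]) (use l in blast)
  have deriv: "(coord c \<circ> \<gamma> has_vector_derivative \<Delta>) (at t within {0..1})" if "t \<in> {0..1}" for t
  proof (rule has_vector_derivative_transform[OF that])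
    show "(l has_vector_derivative \<Delta>) (at t within {0..1})"
      unfolding l_def by (auto intro!: derivative_eq_intros)
  qed (simp add: coord)
  have "C1_curve_on \<A> 0 1 \<gamma>"
    unfolding C1_curve_on_def split_beta
  proof (intro conjI cont ballI)
    fix c' assume c': "c' \<in> \<A>"
    let ?T = "{t \<in> {0..1}. \<gamma> t \<in> dom c'}"
    \<comment> \<open>\<open>C1_curve_on\<close> speaks about every chart of the atlas, so the
      constant velocity in \<open>c\<close> is carried over to \<open>c'\<close>.\<close>
    let ?v = "\<lambda>t. frechet_derivative (transition c c') (at (l t)) \<Delta>"
    have "l t \<in> coord c ` (dom c \<inter> dom c')" if "t \<in> ?T" for t
      using that dom[of t] coord[of t] by (metis (mono_tags, lifting) IntI image_eqI mem_Collect_eq)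
    then have "continuous_on ?T ?v"
      by (intro continuous_on_compose2[OF transition_derivative_continuous[OF c c'] cont_l]) blast
    moreover have "(coord c' \<circ> \<gamma> has_vector_derivative ?v t) (at t within {0..1})"
      if "t \<in> {0..1}" "\<gamma> t \<in> dom c'" for t
      using has_vector_derivative_change_chart[OF c c' that(1) dom[OF that(1)] that(2) _ deriv[OF that(1)]]
        cont that(1) by (simp add: continuous_on_eq_continuous_within coord)
    ultimately show "\<exists>v. continuous_on ?T v \<and>
        (\<forall>t\<in>{0..1}. \<gamma> t \<in> dom c' \<longrightarrow> (coord c' \<circ> \<gamma> has_vector_derivative v t) (at t within {0..1}))"
      by blast
  qed
  then show "piecewise_C1_curve \<A> \<gamma>"
    unfolding piecewise_C1_curve_def by (intro exI[of _ 1] exI[of _ real]) simp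
  have "curve_speed \<A> g \<gamma> t = chart_norm c (l t) \<Delta>" if "t \<in> {0..1} - {0, 1}" for t
  proof -
    have t: "t \<in> {0..1}" and at: "at t within {0..1} = at t"
      using that by (auto intro!: at_within_Icc_at)
    have "isCont \<gamma> t"
      using cont[unfolded continuous_on_eq_continuous_within, rule_format, OF t] at by simp
    then show ?thesis
      using curve_speed_eq[of c \<gamma> t \<Delta>] c dom[OF t] deriv[OF t] at coord[OF t] by simp
  qed
  then have "integral {0..1} (\<lambda>t. chart_norm c (l t) \<Delta>) = curve_length \<A> g \<gamma>"
    unfolding curve_length_def by (intro integral_spike[of "{0, 1}"]) auto
  then show "curve_length \<A> g \<gamma> = integral {0..1} (\<lambda>t. chart_norm c (b + t *\<^sub>R (b' - b)) (b' - b))"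
    by (simp add: l_def \<Delta>_def)
qed

lemma riemannian_dist_pt_le:
  fixes b b' :: 'e
  assumes c: "c \<in> \<A>" and seg: "closed_segment b b' \<subseteq> coords c"
    and K: "\<And>w. w \<in> closed_segment b b' \<Longrightarrow> chart_norm c w (b' - b) \<le> K"
  shows "riemannian_dist \<A> g (pt c b) (pt c b') \<le> K"
proof -
  define l where "l t = b + t *\<^sub>R (b' - b)" for t
  define \<gamma> where "\<gamma> = (\<lambda>t. pt c (l t))"
  have l_seg: "l t \<in> closed_segment b b'" if "t \<in> {0..1}" for t
    unfolding in_segment using that by (intro exI[of _ t]) (auto simp: l_def algebra_simps)
  have "continuous_on {0..1} (\<lambda>t. chart_norm c (l t) (b' - b))"
    by (intro continuous_on_chart_norm c) (use l_seg seg in \<open>auto simp: l_def intro!: continuous_intros\<close>)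
  then have "integral {0..1} (\<lambda>t. chart_norm c (l t) (b' - b)) \<le> integral {0..1} (\<lambda>t::real. K)"
    by (intro integral_le integrable_continuous_interval) (use K l_seg in auto)
  then have "curve_length \<A> g \<gamma> \<le> K"
    using segment_curve(2)[OF c seg] by (simp add: \<gamma>_def l_def)
  moreover have "piecewise_C1_curve \<A> \<gamma>"
    using segment_curve(1)[OF c seg] by (simp add: \<gamma>_def l_def)
  moreover have "\<gamma> 0 = pt c b" "\<gamma> 1 = pt c b'"
    by (simp_all add: \<gamma>_def l_def)
  moreover have "bdd_below (curve_length \<A> g ` S)" for S
    by (rule bdd_belowI2[of _ 0]) (simp add: curve_length_def integral_curve_speed_nonneg)
  ultimately show ?thesis
    unfolding riemannian_dist_def by (intro cINF_lower2) auto
qed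

text \<open>Along a curve, the function which is the distance to \<open>b\<close> in the norm frozen at \<open>a\<close>, cut off at
  \<open>\<kappa>\<close> and extended by \<open>\<kappa>\<close> outside of the chart, grows at most by \<open>C\<close> times the length. This needs
  no discussion of the time at which the curve leaves the chart.\<close>

lemma curve_length_ge:
  assumes c: "c \<in> \<A>" "a \<in> coords c" and V: "open V" "V \<subseteq> coords c"
    and "0 \<le> \<kappa>" and ball: "{w. chart_norm c a (w - b) \<le> \<kappa>} \<subseteq> V"
    and "0 \<le> C" and C: "\<And>w v. w \<in> V \<Longrightarrow> chart_norm c a v \<le> C * chart_norm c w v"
    and \<gamma>: "piecewise_C1_curve \<A> \<gamma>" "\<gamma> 0 = pt c b"
  shows "(if \<gamma> 1 \<in> pt c ` V then min (chart_norm c a (coord c (\<gamma> 1) - b)) \<kappa> else \<kappa>)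
    \<le> C * curve_length \<A> g \<gamma>"
proof -
  interpret inner_form "g c (pt c a)"
    by (rule inner_form_pt) (use c in auto)
  have N: "chart_norm c a = fnorm"
    by (rule chart_norm_eq) (use c in auto)
  define W where "W = pt c ` V"
  define K where "K = {w. fnorm (w - b) \<le> \<kappa>}"
  define F where "F z = (if z \<in> W then min (fnorm (coord c z - b)) \<kappa> else \<kappa>)" for z
  have "K \<subseteq> V"
    using ball by (simp add: K_def N)
  have "open W"
    unfolding W_def by (rule open_pt_image) (use c V in auto)
  have coord_W: "coord c z \<in> V" "z \<in> dom c" if "z \<in> W" for z
    using that V by (auto simp: W_def coord_pt subset_iff pt_in_dom)
  \<comment> \<open>Compactness makes the image of \<open>K\<close> closed in the whole Hausdorff
    space, not merely in the chart domain.\<close>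
  have "compact K"
  proof -
    obtain m M where m: "0 < m" "\<And>v. m * norm v \<le> chart_norm c a v"
      using chart_norm_equivalent[OF c] by metis
    have "K \<subseteq> cball b (\<kappa> / m)"
    proof
      fix w assume "w \<in> K"
      then have "m * norm (w - b) \<le> \<kappa>"
        using m(2)[of "w - b"] by (simp add: K_def N)
      then show "w \<in> cball b (\<kappa> / m)"
        using m(1) by (simp add: dist_norm norm_minus_commute field_simps)
    qed
    moreover have "continuous_on UNIV (\<lambda>w. chart_norm c a (w - b))"
      by (intro continuous_on_chart_norm continuous_intros) (use c in auto)
    then have "closed K"
      unfolding K_def N by (intro closed_Collect_le continuous_intros)
    ultimately show ?thesis
      using bounded_subset[OF bounded_cball] compact_eq_bounded_closed by blast
  qed
  then have "compact (pt c ` K)"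
    using \<open>K \<subseteq> V\<close> V(2) by (intro compact_continuous_image continuous_on_subset[OF continuous_on_pt[OF c(1)]]) auto
  then have "open (- pt c ` K)"
    by (simp add: compact_imp_closed open_Compl)
  have "F (\<gamma> 1) - F (\<gamma> 0) \<le> C * curve_length \<A> g \<gamma>"
  proof (rule piecewise_C1_curve_increment_le[OF \<gamma>(1), where f = "\<lambda>t. F (\<gamma> t)"])
    fix a' b' x assume C1: "C1_curve_on \<A> a' b' \<gamma>" and x: "x \<in> {a'..b'}"
    show "\<exists>\<delta>>0. \<forall>s t. a' \<le> s \<and> s \<le> x \<and> x \<le> t \<and> t \<le> b' \<and> t - s < \<delta> \<longrightarrow>
        F (\<gamma> t) - F (\<gamma> s) \<le> C * integral {s..t} (curve_speed \<A> g \<gamma>)"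
    proof (cases "\<gamma> x \<in> W")
      case True
      obtain \<delta> where "0 < \<delta>" and
        \<delta>: "\<forall>s t. a' \<le> s \<and> s \<le> x \<and> x \<le> t \<and> t \<le> b' \<and> t - s < \<delta> \<longrightarrow> \<gamma> ` {s..t} \<subseteq> W"
        using C1_curve_near[OF C1 x \<open>open W\<close> True] by blast
      show ?thesis
      proof (intro exI[of _ \<delta>] conjI allI impI)
        fix s t assume st: "a' \<le> s \<and> s \<le> x \<and> x \<le> t \<and> t \<le> b' \<and> t - s < \<delta>"
        then have "\<gamma> ` {s..t} \<subseteq> W"
          using \<delta> by blast
        then have in_W: "\<gamma> \<tau> \<in> W" if "\<tau> \<in> {s..t}" for \<tau>
          using that by blast
        have "fnorm (coord c (\<gamma> t) - coord c (\<gamma> s)) \<le> C * integral {s..t} (curve_speed \<A> g \<gamma>)"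
          unfolding N[symmetric]
          by (rule chart_norm_increment_le[OF C1])
            (use st c \<open>0 \<le> C\<close> in_W coord_W C in auto)
        moreover have "F (\<gamma> t) - F (\<gamma> s) \<le> fnorm (coord c (\<gamma> t) - coord c (\<gamma> s))"
          using fnorm_diff_le[of "coord c (\<gamma> t)" b "coord c (\<gamma> s)"]
            fnorm_nonneg[of "coord c (\<gamma> t) - coord c (\<gamma> s)"] in_W[of s] in_W[of t] st
          by (auto simp: F_def min_def)
        ultimately show "F (\<gamma> t) - F (\<gamma> s) \<le> C * integral {s..t} (curve_speed \<A> g \<gamma>)"
          by linarith
      qed (rule \<open>0 < \<delta>\<close>)
    next
      case False
      then have "\<gamma> x \<in> - pt c ` K"
        using \<open>K \<subseteq> V\<close> by (auto simp: W_def)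
      then obtain \<delta> where "0 < \<delta>" and
        \<delta>: "\<forall>s t. a' \<le> s \<and> s \<le> x \<and> x \<le> t \<and> t \<le> b' \<and> t - s < \<delta> \<longrightarrow> \<gamma> ` {s..t} \<subseteq> - pt c ` K"
        using C1_curve_near[OF C1 x \<open>open (- pt c ` K)\<close>] by blast
      \<comment> \<open>Off the image of \<open>K\<close> the cut-off is active or \<open>z\<close>
        lies outside \<open>W\<close>, so \<open>F\<close> is locally constant around any point
        outside \<open>W\<close>.\<close>
      have F_eq: "F z = \<kappa>" if z: "z \<in> - pt c ` K" for z
      proof (cases "z \<in> W")
        case True
        then have "coord c z \<notin> K"
          using z coord_W(2)[OF True] pt_coord[OF c(1), of z] by (metis ComplD image_eqI)
        then show ?thesis
          by (auto simp: F_def K_def)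
      qed (simp add: F_def)
      show ?thesis
      proof (intro exI[of _ \<delta>] conjI allI impI)
        fix s t assume st: "a' \<le> s \<and> s \<le> x \<and> x \<le> t \<and> t \<le> b' \<and> t - s < \<delta>"
        then have "\<gamma> ` {s..t} \<subseteq> - pt c ` K"
          using \<delta> by blast
        moreover have "s \<in> {s..t}" "t \<in> {s..t}"
          using st by auto
        ultimately have "F (\<gamma> s) = \<kappa>" "F (\<gamma> t) = \<kappa>"
          by (blast intro: F_eq)+
        then show "F (\<gamma> t) - F (\<gamma> s) \<le> C * integral {s..t} (curve_speed \<A> g \<gamma>)"
          using integral_curve_speed_nonneg \<open>0 \<le> C\<close> by simp
      qed (rule \<open>0 < \<delta>\<close>)
    qed
  qed
  moreover have "fnorm 0 = 0"
    by (simp add: fnorm_eq_0)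
  then have "b \<in> K"
    using \<open>0 \<le> \<kappa>\<close> by (simp add: K_def)
  then have "b \<in> V"
    using \<open>K \<subseteq> V\<close> by blast
  then have "\<gamma> 0 \<in> W" "coord c (\<gamma> 0) = b"
    using V by (auto simp: \<gamma> W_def coord_pt subset_iff)
  then have "F (\<gamma> 0) = 0"
    using \<open>fnorm 0 = 0\<close> \<open>0 \<le> \<kappa>\<close> by (simp add: F_def)
  ultimately have "F (\<gamma> 1) \<le> C * curve_length \<A> g \<gamma>"
    by simp
  then show ?thesis
    by (simp only: F_def W_def N)
qed

text \<open>Passes to the infimum in \<open>curve_length_ge\<close>. The assumption
  \<open>ne\<close> is essential to this step: over no curves the infimum is an unspecified
  number.\<close>

lemma riemannian_dist_ge:
  assumes c: "c \<in> \<A>" "a \<in> coords c" and V: "open V" "V \<subseteq> coords c"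
    and "0 \<le> \<kappa>" and ball: "{w. chart_norm c a (w - b) \<le> \<kappa>} \<subseteq> V"
    and "0 < C" and C: "\<And>w v. w \<in> V \<Longrightarrow> chart_norm c a v \<le> C * chart_norm c w v"
    and ne: "{\<gamma>. piecewise_C1_curve \<A> \<gamma> \<and> \<gamma> 0 = pt c b \<and> \<gamma> 1 = y} \<noteq> {}"
  shows "(if y \<in> pt c ` V then min (chart_norm c a (coord c y - b)) \<kappa> else \<kappa>) / C
    \<le> riemannian_dist \<A> g (pt c b) y"
  unfolding riemannian_dist_def
proof (rule cINF_greatest[OF ne])
  fix \<gamma> assume "\<gamma> \<in> {\<gamma>. piecewise_C1_curve \<A> \<gamma> \<and> \<gamma> 0 = pt c b \<and> \<gamma> 1 = y}"
  then have "(if y \<in> pt c ` V then min (chart_norm c a (coord c y - b)) \<kappa> else \<kappa>)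
      \<le> C * curve_length \<A> g \<gamma>"
    using curve_length_ge[OF c V \<open>0 \<le> \<kappa>\<close> ball _ C, of \<gamma>] \<open>0 < C\<close> by auto
  then show "(if y \<in> pt c ` V then min (chart_norm c a (coord c y - b)) \<kappa> else \<kappa>) / C
      \<le> curve_length \<A> g \<gamma>"
    using \<open>0 < C\<close> by (simp add: pos_divide_le_eq mult.commute)
qed

section \<open>Distance to the frontier and points around an isolated frontier point\<close>

text \<open>A curve from \<open>x\<close> to a point outside \<open>U\<close> must cross a small
  chart ball contained in \<open>U\<close>, which costs a fixed length. Only positivity of the bound
  matters, so the norms are compared with the crude factor 2.\<close>

lemma riemannian_dist_bounded_below:
  assumes metric: "Metric_space UNIV (riemannian_dist \<A> g)"
    and "open U" "x \<in> U"
  shows "\<exists>k>0. \<forall>y. y \<notin> U \<longrightarrow> k \<le> riemannian_dist \<A> g x y"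
proof -
  interpret Metric_space UNIV "riemannian_dist \<A> g"
    by (rule metric)
  obtain c where c: "c \<in> \<A>" "x \<in> dom c"
    by (rule ex_chart)
  define a where "a = coord c x"
  have a: "a \<in> coords c" "pt c a = x"
    using c by (simp_all add: a_def pt_coord)
  obtain r where r: "0 < r" "ball a r \<subseteq> coords c"
    "\<And>b v. b \<in> ball a r \<Longrightarrow> chart_norm c b v \<le> (1 + 1) * chart_norm c a v"
    "\<And>b v. b \<in> ball a r \<Longrightarrow> chart_norm c a v \<le> (1 + 1) * chart_norm c b v"
    using chart_norm_nearly_constant[OF c(1) a(1), of 1] by (metis zero_less_one)
  have "open (coord c ` (dom c \<inter> U))" "a \<in> coord c ` (dom c \<inter> U)"
    using open_coord_image c \<open>open U\<close> \<open>x \<in> U\<close> by (auto simp: a_def)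
  then obtain r' where r': "0 < r'" "ball a r' \<subseteq> coord c ` (dom c \<inter> U)"
    using open_contains_ball by blast
  define s where "s = min r r'"
  have "0 < s"
    using r r' by (simp add: s_def)
  obtain m M where m: "0 < m" "\<And>v. m * norm v \<le> chart_norm c a v"
    using chart_norm_equivalent[OF c(1) a(1)] by metis
  \<comment> \<open>Chosen so that the closed frozen-norm ball of radius \<open>\<kappa>\<close> has
    Euclidean radius at most \<open>s / 2\<close> and fits into \<open>ball a s\<close>.\<close>
  define \<kappa> where "\<kappa> = m * s / 2"
  have "0 < \<kappa>"
    using m \<open>0 < s\<close> by (simp add: \<kappa>_def)
  have ball: "{w. chart_norm c a (w - a) \<le> \<kappa>} \<subseteq> ball a s"
  proof
    fix w assume "w \<in> {w. chart_norm c a (w - a) \<le> \<kappa>}"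
    then have "m * norm (w - a) \<le> m * (s / 2)"
      using m(2)[of "w - a"] by (simp add: \<kappa>_def)
    then have "norm (w - a) \<le> s / 2"
      using m(1) by (simp only: mult_le_cancel_left_pos)
    then show "w \<in> ball a s"
      using \<open>0 < s\<close> by (simp add: dist_norm norm_minus_commute)
  qed
  have pt_U: "pt c ` ball a s \<subseteq> U"
  proof
    fix z assume "z \<in> pt c ` ball a s"
    then obtain w where w: "w \<in> ball a s" "z = pt c w"
      by blast
    then have "w \<in> coord c ` (dom c \<inter> U)"
      using r' by (auto simp: s_def)
    then show "z \<in> U"
      using w(2) pt_coord[OF c(1)] by auto
  qed
  define j :: real where "j = Inf {}"
  have "min (\<kappa> / 2) (if 0 < j then j else 1) \<le> riemannian_dist \<A> g x y" if y: "y \<notin> U" for y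
  proof (cases "{\<gamma>. piecewise_C1_curve \<A> \<gamma> \<and> \<gamma> 0 = pt c a \<and> \<gamma> 1 = y} = {}")
    case True
    \<comment> \<open>The infimum over no curves is the unspecified number \<open>j\<close>, but it is a value of a metric.
      This replaces a proof that the manifold is connected by piecewise smooth curves.\<close>
    then have "riemannian_dist \<A> g x y = j"
      unfolding riemannian_dist_def a(2) j_def by (simp only: image_empty)
    moreover have "0 < riemannian_dist \<A> g x y"
      using mdist_pos_less[of x y] y \<open>x \<in> U\<close> by auto
    ultimately show ?thesis
      by simp
  next
    case False
    have "(if y \<in> pt c ` ball a s then min (chart_norm c a (coord c y - a)) \<kappa> else \<kappa>) / 2
        \<le> riemannian_dist \<A> g (pt c a) y"
      by (rule riemannian_dist_ge[OF c(1) a(1) open_ball _ _ ball _ _ False])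
        (use r \<open>0 < \<kappa>\<close> in \<open>auto simp: s_def\<close>)
    moreover have "y \<notin> pt c ` ball a s"
      using y pt_U by blast
    ultimately show ?thesis
      by (simp add: a)
  qed
  moreover have "0 < min (\<kappa> / 2) (if 0 < j then j else 1)"
    using \<open>0 < \<kappa>\<close> by simp
  ultimately show ?thesis
    by blast
qed

text \<open>The centre is in the closure of \<open>U\<close> but not in \<open>U\<close>, so the
  punctured ball meets \<open>U\<close>. From dimension two on it is connected, and a connected set
  that meets \<open>U\<close> and misses the frontier lies in \<open>U\<close>.\<close>

lemma punctured_chart_ball_subset:
  assumes "2 \<le> DIM('e)" and c: "c \<in> \<A>" and r: "0 < r" "ball a r \<subseteq> coords c"
    and U: "open U" "pt c a \<in> frontier U"
    and isolated: "pt c ` (ball a r - {a}) \<inter> frontier U = {}"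
  shows "pt c ` (ball a r - {a}) \<subseteq> U"
proof -
  have "open (pt c ` ball a r)" "pt c a \<in> pt c ` ball a r"
    using open_pt_image c r by auto
  moreover have "pt c a \<in> closure U" "pt c a \<notin> U"
    using U by (auto simp: frontier_def interior_open)
  ultimately have "U \<inter> pt c ` ball a r \<noteq> {}"
    by (meson disjoint_iff open_Int_closure_eq_empty)
  then have "pt c ` (ball a r - {a}) \<inter> U \<noteq> {}"
    using \<open>pt c a \<notin> U\<close> by blast
  moreover have "connected (pt c ` (ball a r - {a}))"
  proof (rule connected_continuous_image)
    show "continuous_on (ball a r - {a}) (pt c)"
      using r by (intro continuous_on_subset[OF continuous_on_pt[OF c]]) auto
    show "connected (ball a r - {a})"
      using assms(1) by (intro connected_punctured_ball) auto
  qed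
  ultimately show ?thesis
    using connected_Int_frontier[of "pt c ` (ball a r - {a})" U] isolated by blast
qed

text \<open>The witnesses have coordinates \<open>a - e *\<^sub>R v\<close> and
  \<open>a + e *\<^sub>R v\<close> with \<open>v\<close> of frozen norm 1. Segments bound their
  distances to \<open>p\<close> from above; \<open>riemannian_dist_ge\<close>, based at the first
  witness, bounds their mutual distance from below.\<close>

lemma antipodal_at_isolated_frontier_point:
  assumes metric: "Metric_space UNIV (riemannian_dist \<A> g)"
    and dim: "2 \<le> DIM('e)" and U: "open U" "p \<in> frontier U"
    and D: "0 < D" "\<And>u. u \<in> frontier U - {p} \<Longrightarrow> D \<le> riemannian_dist \<A> g p u"
  shows "antipodal_at (riemannian_dist \<A> g) U p"
  unfolding antipodal_at_def
proof (intro allI impI)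
  fix \<eta> :: real assume "0 < \<eta>"
  interpret Metric_space UNIV "riemannian_dist \<A> g"
    by (rule metric)
  obtain c where c: "c \<in> \<A>" "p \<in> dom c"
    by (rule ex_chart)
  define a where "a = coord c p"
  have a: "a \<in> coords c" "pt c a = p"
    using c by (simp_all add: a_def pt_coord)
  obtain r where r: "0 < r" "ball a r \<subseteq> coords c"
    "\<And>b v. b \<in> ball a r \<Longrightarrow> chart_norm c b v \<le> (1 + \<eta>) * chart_norm c a v"
    "\<And>b v. b \<in> ball a r \<Longrightarrow> chart_norm c a v \<le> (1 + \<eta>) * chart_norm c b v"
    by (rule chart_norm_nearly_constant[OF c(1) a(1) \<open>0 < \<eta>\<close>]) blast
  obtain m M where mM: "0 < m" "0 < M" "\<And>v. m * norm v \<le> chart_norm c a v"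
    "\<And>v. chart_norm c a v \<le> M * norm v"
    by (rule chart_norm_equivalent[OF c(1) a(1)]) blast
  have upper: "riemannian_dist \<A> g p (pt c b) \<le> (1 + \<eta>) * chart_norm c a (b - a)"
    if b: "b \<in> ball a r" for b
  proof -
    have seg: "closed_segment a b \<subseteq> ball a r"
      using b r(1) by (intro closed_segment_subset) auto
    have "riemannian_dist \<A> g (pt c a) (pt c b) \<le> (1 + \<eta>) * chart_norm c a (b - a)"
      by (rule riemannian_dist_pt_le[OF c(1)]) (use seg r in auto)
    then show ?thesis
      by (simp add: a)
  qed
  \<comment> \<open>Points of \<open>ball a s\<close> are closer than \<open>D\<close> to
    \<open>p\<close>, because the distance is at most \<open>(1 + \<eta>) * M\<close> times the
    Euclidean one.\<close>
  define s where "s = min r (D / ((1 + \<eta>) * M))"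
  have "0 < s"
    using r(1) D(1) mM(2) \<open>0 < \<eta>\<close> by (simp add: s_def)
  have "pt c b \<notin> frontier U" if b: "b \<in> ball a s - {a}" for b
  proof
    assume "pt c b \<in> frontier U"
    have "b \<in> ball a r"
      using b by (simp add: s_def)
    then have "coord c (pt c b) = b"
      using r(2) by (blast intro: coord_pt)
    then have "pt c b \<noteq> p"
      using b by (auto simp: a_def)
    then have "D \<le> riemannian_dist \<A> g p (pt c b)"
      using D(2) \<open>pt c b \<in> frontier U\<close> by simp
    also have "\<dots> \<le> (1 + \<eta>) * (M * norm (b - a))"
      using upper[OF \<open>b \<in> ball a r\<close>] mM(4)[of "b - a"] \<open>0 < \<eta>\<close>
      by (meson add_nonneg_nonneg less_imp_le mult_left_mono order_trans zero_le_one)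
    also have "\<dots> = ((1 + \<eta>) * M) * norm (b - a)"
      by simp
    also have "\<dots> < ((1 + \<eta>) * M) * (D / ((1 + \<eta>) * M))"
      using b mM(2) \<open>0 < \<eta>\<close> by (intro mult_strict_left_mono) (auto simp: s_def dist_norm norm_minus_commute)
    also have "\<dots> = D"
      using mM(2) \<open>0 < \<eta>\<close> by simp
    finally show False
      by simp
  qed
  then have isolated: "pt c ` (ball a s - {a}) \<inter> frontier U = {}"
    by blast
  have "ball a s \<subseteq> coords c" "pt c a \<in> frontier U"
    using r(2) U(2) a(2) by (auto simp: s_def)
  then have in_U: "pt c ` (ball a s - {a}) \<subseteq> U"
    by (intro punctured_chart_ball_subset[OF dim c(1) \<open>0 < s\<close> _ U(1)] isolated)
  obtain i :: 'e where i: "i \<in> Basis"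
    using nonempty_Basis by blast
  have i_pos: "0 < chart_norm c a i"
    using c a i nonzero_Basis by (intro chart_norm_pos) auto
  define v where "v = i /\<^sub>R chart_norm c a i"
  have v: "chart_norm c a v = 1" "v \<noteq> 0"
    using i_pos c a i by (auto simp: v_def chart_norm_scaleR)
  define \<kappa> where "\<kappa> = m * r / 4"
  have "0 < \<kappa>"
    using mM r by (simp add: \<kappa>_def)
  have ball: "{w. chart_norm c a (w - b) \<le> \<kappa>} \<subseteq> ball a r" if "dist a b < r / 2" for b
  proof
    fix w assume "w \<in> {w. chart_norm c a (w - b) \<le> \<kappa>}"
    then have "m * norm (w - b) \<le> m * (r / 4)"
      using mM(3)[of "w - b"] by (simp add: \<kappa>_def)
    then have "norm (w - b) \<le> r / 4"
      using mM(1) by (simp only: mult_le_cancel_left_pos)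
    then have "dist b w \<le> r / 4"
      by (simp add: dist_norm norm_minus_commute)
    then have "dist a w < r"
      using that r(1) dist_triangle[of a w b] by linarith
    then show "w \<in> ball a r"
      by simp
  qed
  have small: "\<forall>\<^sub>F e in at_right 0. e * k < l" if "0 < l" for k l :: real
  proof -
    have "((\<lambda>e. e * k) \<longlongrightarrow> 0) (at_right 0)"
      by (auto intro!: tendsto_eq_intros)
    then show ?thesis
      using that by (auto dest: order_tendstoD)
  qed
  have "\<forall>\<^sub>F e in at_right (0::real). 0 < e"
    by (simp add: eventually_at_right_less)
  \<comment> \<open>In turn: the witnesses lie in \<open>U\<close>; \<open>ball\<close> applies to
    the base point; their frozen distance \<open>2 * e\<close> stays below the cut-off
    \<open>\<kappa>\<close>.\<close>
  moreover have "\<forall>\<^sub>F e in at_right 0. e * norm v < s" "\<forall>\<^sub>F e in at_right 0. e * norm v < r / 2"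
    "\<forall>\<^sub>F e in at_right 0. e * 2 < \<kappa>"
    by (rule small; use \<open>0 < s\<close> r(1) \<open>0 < \<kappa>\<close> in simp)+
  ultimately show "\<forall>\<^sub>F e in at_right 0. \<exists>x\<in>U. \<exists>y\<in>U.
      riemannian_dist \<A> g p x \<le> (1 + \<eta>) * e \<and> riemannian_dist \<A> g p y \<le> (1 + \<eta>) * e \<and>
      2 * (1 - \<eta>) * e \<le> riemannian_dist \<A> g x y"
  proof eventually_elim
    case (elim e)
    define b b' where "b = a - e *\<^sub>R v" and "b' = a + e *\<^sub>R v"
    have dists: "dist a b = e * norm v" "dist a b' = e * norm v"
      using elim by (auto simp: b_def b'_def dist_norm)
    have ne: "b \<noteq> a" "b' \<noteq> a"
      using elim v by (auto simp: b_def b'_def)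
    have br: "b \<in> ball a r" "b' \<in> ball a r"
      using dists elim r(1) by auto
    have "pt c b \<in> U" "pt c b' \<in> U"
      using in_U dists elim ne by (auto simp: subset_iff)
    moreover have "chart_norm c a (b - a) = e" "chart_norm c a (b' - a) = e"
      using elim v c a chart_norm_scaleR[of c a "- e" v] chart_norm_scaleR[of c a e v]
      by (auto simp: b_def b'_def)
    then have "riemannian_dist \<A> g p (pt c b) \<le> (1 + \<eta>) * e" "riemannian_dist \<A> g p (pt c b') \<le> (1 + \<eta>) * e"
      using upper[OF br(1)] upper[OF br(2)] by simp_all
    moreover have "2 * (1 - \<eta>) * e \<le> riemannian_dist \<A> g (pt c b) (pt c b')"
    proof -
      have seg: "closed_segment b b' \<subseteq> coords c"
        using closed_segment_subset[OF br convex_ball] r(2) by blast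
      have "piecewise_C1_curve \<A> (\<lambda>t. pt c (b + t *\<^sub>R (b' - b)))"
        by (rule segment_curve(1)[OF c(1) seg])
      then have curves: "{\<gamma>. piecewise_C1_curve \<A> \<gamma> \<and> \<gamma> 0 = pt c b \<and> \<gamma> 1 = pt c b'} \<noteq> {}"
        by (auto intro!: exI[of _ "\<lambda>t. pt c (b + t *\<^sub>R (b' - b))"])
      have "(if pt c b' \<in> pt c ` ball a r then min (chart_norm c a (coord c (pt c b') - b)) \<kappa> else \<kappa>)
          / (1 + \<eta>) \<le> riemannian_dist \<A> g (pt c b) (pt c b')"
        by (rule riemannian_dist_ge[OF c(1) a(1) open_ball r(2) _ ball _ _ curves])
          (use r \<open>0 < \<kappa>\<close> \<open>0 < \<eta>\<close> dists elim in auto)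
      moreover have "coord c (pt c b') = b'"
        using br(2) r(2) by (blast intro: coord_pt)
      moreover have "b' - b = (2 * e) *\<^sub>R v"
        by (simp add: b_def b'_def flip: scaleR_add_left)
      then have "chart_norm c a (b' - b) = e * 2"
        using chart_norm_scaleR[of c a "2 * e" v] c a v elim by simp
      ultimately have "e * 2 / (1 + \<eta>) \<le> riemannian_dist \<A> g (pt c b) (pt c b')"
        using br elim by simp
      \<comment> \<open>Replaces the factor \<open>1 / (1 + \<eta>)\<close> by the smaller
        \<open>1 - \<eta>\<close> used in \<open>antipodal_at\<close>.\<close>
      moreover have "2 * (1 - \<eta>) * e * (1 + \<eta>) = e * 2 - 2 * e * (\<eta> * \<eta>)"
        by (simp add: algebra_simps)
      then have "2 * (1 - \<eta>) * e * (1 + \<eta>) \<le> e * 2"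
        using elim by simp
      then have "2 * (1 - \<eta>) * e \<le> e * 2 / (1 + \<eta>)"
        using \<open>0 < \<eta>\<close> by (subst pos_le_divide_eq) auto
      ultimately show ?thesis
        by linarith
    qed
    ultimately show ?case
      by blast
  qed
qed

end

theorem theorem2p1:
  fixes \<A> :: "('m::{t2_space, second_countable_topology}, 'e::euclidean_space) chart set"
    and g :: "('m, 'e) metric_tensor"
    and d :: "'m \<Rightarrow> 'm \<Rightarrow> real"
    and U :: "'m set" and p q :: 'm and R :: real
  defines "d \<equiv> riemannian_dist \<A> g"
  assumes "riemannian_manifold \<A> g"
    and "DIM('e) \<ge> 2"
    and "Metric_space.mcomplete UNIV d"
    and "ptolemaic UNIV d"
    and "open U" and "p \<in> frontier U" and "q \<in> frontier U"
    and "d p q > 0"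
    and "R > 0"
    and "\<forall>q'\<in>frontier U - {p, q}. d p q' \<ge> d p q \<and> d q q' \<ge> R"
  shows "gromov_hyperbolic (ln 2) U (rho d U) \<and>
    (\<forall>\<delta>. 0 < \<delta> \<and> \<delta> < ln 2 \<longrightarrow> \<not> gromov_hyperbolic \<delta> U (rho d U))"
proof -
  interpret riemannian \<A> g
    by unfold_locales (rule assms)
  have metric: "Metric_space UNIV d"
    using \<open>ptolemaic UNIV d\<close> by (simp add: ptolemaic_def)
  interpret ptolemaic_domain d U
  proof
    show "ptolemaic UNIV d" "frontier U \<noteq> {}"
      using assms by auto
    fix x assume "x \<in> U"
    then obtain k where k: "0 < k" "\<And>y. y \<notin> U \<Longrightarrow> k \<le> d x y"
      using riemannian_dist_bounded_below metric \<open>open U\<close> unfolding d_def by metis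
    have "k \<le> d u x" if "u \<in> frontier U" for u
      using k(2)[of u] that \<open>open U\<close> Metric_space.commute[OF metric, of u x]
      by (simp add: frontier_def interior_open)
    then show "\<exists>c>0. \<forall>u\<in>frontier U. c \<le> d u x"
      using k(1) by blast
  qed
  have p: "d p q \<le> d p u" if "u \<in> frontier U - {p}" for u
    using that assms(11) by (cases "u = q") auto
  \<comment> \<open>The isolation radius of \<open>q\<close> also has to respect \<open>p\<close>,
    which the bound by \<open>R\<close> leaves out.\<close>
  have q: "min R (d p q) \<le> d q u" if "u \<in> frontier U - {q}" for u
    using that assms(11) commute[of q p] by (cases "u = p") (auto simp: min_le_iff_disj)
  have R: "0 < min R (d p q)"
    using assms by simp
  have "antipodal_at d U p"
    using antipodal_at_isolated_frontier_point[of U p "d p q"] metric assms(3,6,7,9) p unfolding d_def by blast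
  moreover have "antipodal_at d U q"
    using antipodal_at_isolated_frontier_point[of U q "min R (d p q)"] metric assms(3,6,8) R q
    unfolding d_def by blast
  moreover have "p \<noteq> q"
    using \<open>d p q > 0\<close> by auto
  ultimately have "\<not> gromov_hyperbolic \<delta> U (rho d U)" if "\<delta> < ln 2" for \<delta>
    using not_gromov_hyperbolic_rho[OF assms(7) _ assms(8) _ _ assms(9) p R q that] by blast
  then show ?thesis
    using gromov_hyperbolic_rho by blast
qed

end
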